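(* Fix nonempty totally ordered sets $X, Y$ and an integer $p \geq 1$. Fix $k_1, \dots, k_p, l \in \mathbb{Z}_{>0} \cup \{\infty\}$, and define $\mathcal{N} := \min\{|X|, |Y|, l\} \in \mathbb{Z}_{>0} \sqcup \{\infty\}$. Consider functions $F : (0,\infty)^p \to (0,\infty)$ satisfying the following property: $$(\ast)\qquad F \circ \mathbf{K} \in \mathrm{TP}^{(l)}_{X \times Y} \quad \text{whenever } \mathbf{K} = (K_1,\dots,K_p) \text{ with } K_j \in \mathrm{TP}^{(k_j)}_{X\times Y} \text{ for all } j \in [p].$$ 1. If $\mathcal{N} = 1$, then the maps $F$ satisfying $(\ast)$ are all functions $(0,\infty)^p \to (0,\infty)$. 2. If $\mathcal{N} = 2$, then the maps $F : (0,\infty)^p \to (0,\infty)$ satisfying $(\ast)$ are the "mixed power functions" $F(\mathbf{t}) = c \prod_{j=1}^p t_j^{\alpha_j}$ for some reals $c > 0$ and $\alpha_j \geq 0$, with $(\alpha_1,\dots,\alpha_p) \neq \mathbf{0}$, and $\alpha_j = 0$ if $k_j < \mathcal{N}$. 3. If $\mathcal{N} = 3$, then the functions $F$ satisfying $(\ast)$ are the individual powers $F(\mathbf{t}) = c\, t_j^{\alpha_j}$ for a single $j \in [p]$, with $c > 0$, $\alpha_j \geq 1$, and $k_j \geq \mathcal{N}$. 4. In all other cases, i.e. if $4 \leq \mathcal{N} \leq \infty$, further assume that if $X, Y$ are both infinite but $l < \infty$ then all $k_j$ are finite. Then the functions $F$ satisfying $(\ast)$ are the homotheties $F(\mathbf{t})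 = c\, t_j$ for a single $j \in [p]$, with $c > 0$ and $k_j \geq \mathcal{N}$.
   Context: For a positive integer $p$, $[p] := \{1,\dots,p\}$. $|X|$ is the number of elements of $X$, taken to be $\infty$ if $X$ is infinite. For a totally ordered set $X$ and integer $r\ge 1$, let $X^{r,\uparrow} := \{(x_1,\dots,x_r) \in X^r : x_1 < \cdots < x_r\}$. For a kernel $K : X \times Y \to [0,\infty)$, $\mathbf{x} \in X^{r,\uparrow}$ and $\mathbf{y} \in Y^{r,\uparrow}$, let $K[\mathbf{x};\mathbf{y}] := (K(x_i,y_j))_{i,j=1}^r$. For an integer $k \ge 1$, $K$ is totally positive of order $k$, written $K \in \mathrm{TP}^{(k)}_{X\times Y}$, if $\det K[\mathbf{x};\mathbf{y}] > 0$ for all integers $1 \le r \le k$ and all $\mathbf{x} \in X^{r,\uparrow}$, $\mathbf{y} \in Y^{r,\uparrow}$ (in particular $K>0$). $K \in \mathrm{TP}^{(\infty)}_{X \times Y}$ means this holds for all integers $k\ge 1$. For $F : (0,\infty)^p \to (0,\infty)$ and a tuple $\mathbf{K} = (K_1,\dots,K_p)$ of kernels $K_j : X \times Y \to (0,\infty)$, $F \circ \mathbf{K}$ is the kernel $(x,y) \mapsto F(K_1(x,y),\dots,K_p(x,y))$.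
   Formalization: For N ≥ 2 it is also assumed that some tuple K with K_j in TP^(k_j) on X×Y for all j exists; otherwise (e.g. X = ω_1, Y = {1,2}, p = 1, k_1 = l = 2) every F satisfies (∗) vacuously and cases 2–4 fail. *)

theory Defs
  imports
    Complex_Main
    "HOL-Library.Extended_Nat"
    "HOL-Library.FuncSet"
    "Jordan_Normal_Form.Determinant"
begin

definition ecard :: "'a set \<Rightarrow> enat" where
  "ecard X = (if finite X then enat (card X) else \<infinity>)"

definition incr_tuples :: "nat \<Rightarrow> 'a::linorder set \<Rightarrow> 'a list set" where
  "incr_tuples r X = {xs. length xs = r \<and> set xs \<subseteq> X \<and> sorted_wrt (<) xs}"

definition kernel_mat :: "('a \<Rightarrow> 'b \<Rightarrow> real) \<Rightarrow> 'a list \<Rightarrow> 'b list \<Rightarrow> real mat" where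
  "kernel_mat K xs ys = mat (length xs) (length ys) (\<lambda>(i, j). K (xs ! i) (ys ! j))"

(* A kernel on X \<times> Y is a curried function of which only the values on X \<times> Y matter.
   Positivity of K on X \<times> Y is the case r = 1, see TP_pos. The order k ranges over enat, so
   that k = \<infinity> imposes the condition for every r. *)
definition TP :: "'a::linorder set \<Rightarrow> 'b::linorder set \<Rightarrow> enat \<Rightarrow> ('a \<Rightarrow> 'b \<Rightarrow> real) set" where
  "TP X Y k = {K. \<forall>r. 1 \<le> r \<and> enat r \<le> k \<longrightarrow>
     (\<forall>xs \<in> incr_tuples r X. \<forall>ys \<in> incr_tuples r Y. det (kernel_mat K xs ys) > 0)}"

(* The points of (0,\<infinity>)^p, with a finite type 'p of cardinality p in the role of [p]. *)
definition pos_orthant :: "('p::finite \<Rightarrow> real) set" where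
  "pos_orthant = {t. \<forall>j. 0 < t j}"

definition compose_kernels ::
  "(('p \<Rightarrow> real) \<Rightarrow> real) \<Rightarrow> ('p \<Rightarrow> 'a \<Rightarrow> 'b \<Rightarrow> real) \<Rightarrow> 'a \<Rightarrow> 'b \<Rightarrow> real" where
  "compose_kernels F K = (\<lambda>x y. F (\<lambda>j. K j x y))"

definition preserves_TP ::
  "'a::linorder set \<Rightarrow> 'b::linorder set \<Rightarrow> ('p::finite \<Rightarrow> enat) \<Rightarrow> enat \<Rightarrow>
   (('p \<Rightarrow> real) \<Rightarrow> real) \<Rightarrow> bool" where
  "preserves_TP X Y k l F \<longleftrightarrow>
     (\<forall>K. (\<forall>j. K j \<in> TP X Y (k j)) \<longrightarrow> compose_kernels F K \<in> TP X Y l)"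

definition eff_order :: "'a set \<Rightarrow> 'b set \<Rightarrow> enat \<Rightarrow> enat" where
  "eff_order X Y l = min (ecard X) (min (ecard Y) l)"

lemma TP_D:
  assumes "K \<in> TP X Y k" "1 \<le> r" "enat r \<le> k" "xs \<in> incr_tuples r X" "ys \<in> incr_tuples r Y"
  shows "det (kernel_mat K xs ys) > 0"
  using assms unfolding TP_def by blast

lemma TP_pos:
  assumes "K \<in> TP X Y k" "1 \<le> k" "x \<in> X" "y \<in> Y"
  shows "K x y > 0"
proof -
  have "[x] \<in> incr_tuples 1 X" "[y] \<in> incr_tuples 1 Y"
    using assms by (auto simp: incr_tuples_def)
  then have "det (kernel_mat K [x] [y]) > 0"
    using assms(1,2) by (auto intro!: TP_D[of K X Y k 1] simp: one_enat_def)
  then show ?thesis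
    by (simp add: det_single kernel_mat_def)
qed

(* If Y has two points, a kernel of order at least 2 embeds X into the reals. Over a set X
   without such an embedding (the ordinal omega_1, say) there are hence no such kernels, and
   every F preserves them vacuously. *)
lemma TP_strict_mono_ratio:
  assumes K: "K \<in> TP X Y k" and k: "2 \<le> k" and y: "y1 \<in> Y" "y2 \<in> Y" "y1 < y2"
  shows "strict_mono_on X (\<lambda>x. K x y2 / K x y1)"
proof (rule strict_mono_onI)
  fix x1 x2 assume x: "x1 \<in> X" "x2 \<in> X" "x1 < x2"
  have "[x1, x2] \<in> incr_tuples 2 X" "[y1, y2] \<in> incr_tuples 2 Y"
    using x y by (auto simp: incr_tuples_def)
  moreover have "enat 2 \<le> k"
    using k by (simp add: numeral_eq_enat)
  ultimately have "det (kernel_mat K [x1, x2] [y1, y2]) > 0"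
    by (intro TP_D[OF K, of 2]) simp_all
  then have "K x1 y2 * K x2 y1 < K x1 y1 * K x2 y2"
    by (subst (asm) laplace_expansion_column[of _ 2 0])
       (simp_all add: kernel_mat_def numeral_2_eq_2 cofactor_def mat_delete_def det_single mult.commute)
  moreover have "1 \<le> k"
    using k by (rule order_trans[rotated]) simp
  then have "K x1 y1 > 0" "K x2 y1 > 0"
    using TP_pos[OF K] x y by blast+
  ultimately show "K x1 y2 / K x1 y1 < K x2 y2 / K x2 y1"
    by (simp add: field_simps)
qed

lemma preserves_TP_vacuous:
  assumes "\<nexists>K. \<forall>j. K j \<in> TP X Y (k j)"
  shows "preserves_TP X Y k l F"
  using assms by (auto simp: preserves_TP_def)

end

theory Submission
  imports Defs "HOL-Real_Asymp.Real_Asymp"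
begin

text \<open>
  Throughout, N is the minimum of the cardinalities of X and Y and of l. The minors that occur in the
  conclusion have size at most N, since larger increasing tuples do not exist.
  
  Sufficiency. For N = 2 the exchange inequality K(x,y') K(x',y) < K(x,y) K(x',y') is kept by positive
  powers and by products. For N = 3, scaling rows and columns of a 3 x 3 matrix so that the first row and
  column become 1 reduces the claim to an inequality between products of numbers (1 + x)^a - 1, which
  says that the logarithm of (1 + e^s)^a - 1 is convex in s for a \<ge> 1 (\<open>powr_shift_log_convex\<close>).
  
  Necessity. The tests of the shape of F use kernels that are totally positive of every order, so
  that they are admissible for each argument of F. An argument with k_j = 1 admits arbitrary positive
  kernels, hence F cannot depend on it. Otherwise a kernel of order 2 embeds X and Y into the reals, by
  maps f and g say, and these embeddings can be chosen to take prescribed values at finitely many points. The kernel exp(f(x) g(y)) is totally positive because an exponential sum with n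
  terms has fewer than n zeros; and a series \<Sum>i. u_i(x) v_i(y) is totally positive if u and v are, by
  Andreief's identity (a form of the Cauchy-Binet formula).
  
  For N \<ge> 2, every 2 x 2 matrix with positive entries and determinant is a submatrix of a scaled
  exponential kernel. Hence u \<mapsto> log F(e^u) satisfies a strict exchange inequality, which makes it affine
  with nonnegative slopes; so F is a mixed power. For N \<ge> 3 the tests are the matrices
  1 + c a^p' b^q' + d a^p b^q with a, b = 0, 1, 2, ..., obtained as limits of totally positive kernels
  by letting all other coefficients of such a series tend to 0; applied to them, F must give nonnegative
  determinants. For c, d \<rightarrow> 0 the leading term of the determinant can be computed:
  1 + c a b forces each positive exponent to be at least 1, the pair 1 + c a b^2, 1 + c a^2 b forbids
  two positive exponents, and, for N \<ge> 4, 1 + c (1000 a b^2 + a^3 b^3) forbids exponents above 1.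
  
  Finally, the sum of the first m terms of a series as above has order m, but its minors of size m + 1
  vanish. If k_j = m < N for the remaining index j, then F = c t_j^a maps a root of that sum, which is
  still of order m, to a multiple of the sum; so k_j \<ge> N.
\<close>

section \<open>Determinants of matrices given by an index function\<close>

text \<open>
  A determinant that sees a matrix only through its entries, so that entries can be rewritten
  without reference to dimensions.
\<close>

definition det_n :: "nat \<Rightarrow> (nat \<Rightarrow> nat \<Rightarrow> real) \<Rightarrow> real" where
  "det_n n M = det (mat n n (\<lambda>(i, j). M i j))"

lemma det_n_Leibniz:
  "det_n n M = (\<Sum>p | p permutes {0..<n}. signof p * (\<Prod>i = 0..<n. M i (p i)))"
proof -
  have "(\<Prod>i = 0..<n. mat n n (\<lambda>(i, j). M i j) $$ (i, p i)) = (\<Prod>i = 0..<n. M i (p i))"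
    if "p permutes {0..<n}" for p
    using permutes_in_image[OF that] by (intro prod.cong) auto
  then show ?thesis
    unfolding det_n_def by (subst det_def'[of _ n]) (auto intro!: sum.cong)
qed

lemma det_n_cong:
  "(\<And>i j. i < n \<Longrightarrow> j < n \<Longrightarrow> M i j = N i j) \<Longrightarrow> det_n n M = det_n n N"
  unfolding det_n_def by (intro arg_cong[of _ _ det] cong_mat) auto

lemma det_n_transpose: "det_n n (\<lambda>i j. M j i) = det_n n M"
proof -
  have "transpose_mat (mat n n (\<lambda>(i, j). M i j)) = mat n n (\<lambda>(i, j). M j i)"
    by (intro eq_matI) auto
  then show ?thesis
    unfolding det_n_def by (metis det_transpose mat_carrier)
qed

lemma det_n_scale:
  "det_n n (\<lambda>i j. a i * b j * M i j) = (\<Prod>i<n. a i) * (\<Prod>j<n. b j) * det_n n M"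
proof -
  have "(\<Prod>i = 0..<n. a i * b (p i) * M i (p i)) =
      (\<Prod>i<n. a i) * (\<Prod>j<n. b j) * (\<Prod>i = 0..<n. M i (p i))"
    if p: "p permutes {0..<n}" for p
  proof -
    have "(\<Prod>i = 0..<n. b (p i)) = (\<Prod>i = 0..<n. b i)"
      using prod.permute[OF p, of b] by (simp add: o_def)
    then show ?thesis
      by (simp add: prod.distrib atLeast0LessThan)
  qed
  then show ?thesis
    unfolding det_n_Leibniz by (simp add: sum_distrib_left mult_ac)
qed

lemma det_n_tendsto:
  assumes "\<And>i j. i < n \<Longrightarrow> j < n \<Longrightarrow> ((\<lambda>m. M m i j) \<longlongrightarrow> L i j) G"
  shows "((\<lambda>m. det_n n (M m)) \<longlongrightarrow> det_n n L) G"
  unfolding det_n_Leibniz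
  by (intro tendsto_sum tendsto_mult tendsto_prod tendsto_const assms)
     (auto simp: permutes_in_image)

lemma det_n_equal_rows:
  assumes "i < n" "j < n" "i \<noteq> j" "\<And>k. k < n \<Longrightarrow> M i k = M j k"
  shows "det_n n M = 0"
  unfolding det_n_def
  by (rule det_identical_rows[of _ n i j]) (use assms in \<open>auto intro!: eq_vecI\<close>)

lemma det_n_permute_rows:
  assumes p: "p permutes {0..<n}"
  shows "det_n n (\<lambda>i. M (p i)) = signof p * det_n n M"
proof -
  have "mat n n (\<lambda>(i, j). mat n n (\<lambda>(i, j). M i j) $$ (p i, j)) = mat n n (\<lambda>(i, j). M (p i) j)"
    using permutes_in_image[OF p] by (intro cong_mat) auto
  then show ?thesis
    unfolding det_n_def using det_permute_rows[OF mat_carrier p, of "\<lambda>(i, j). M i j"] by simp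
qed

text \<open>
  The cofactors C depend only on the upper rows, so that the determinant becomes a fixed linear
  form in the last row; its last coefficient is the leading minor.
\<close>

lemma det_n_laplace_last_row:
  "\<exists>C. C n = det_n n M \<and> (\<forall>v. det_n (Suc n) (\<lambda>i. if i = n then v else M i) = (\<Sum>j\<le>n. C j * v j))"
proof -
  let ?A = "\<lambda>v. mat (Suc n) (Suc n) (\<lambda>(i, j). (if i = n then v else M i) j)"
  let ?C = "\<lambda>j. cofactor (?A undefined) n j"
  have minor: "mat_delete (?A v) n j = mat_delete (?A undefined) n j" for v :: "nat \<Rightarrow> real" and j
    unfolding mat_delete_def by (rule eq_matI) auto
  have "mat_delete (?A undefined) n n = mat n n (\<lambda>(i, j). M i j)"
    unfolding mat_delete_def by (rule eq_matI) auto
  then have Cn: "?C n = det_n n M"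
    by (simp add: cofactor_def det_n_def)
  have C: "det_n (Suc n) (\<lambda>i. if i = n then v else M i) = (\<Sum>j\<le>n. ?C j * v j)" for v
  proof -
    have "det_n (Suc n) (\<lambda>i. if i = n then v else M i) = (\<Sum>j<Suc n. ?A v $$ (n, j) * cofactor (?A v) n j)"
    unfolding det_n_def by (rule laplace_expansion_row) auto
    also have "\<dots> = (\<Sum>j<Suc n. ?C j * v j)"
      by (intro sum.cong) (simp_all add: cofactor_def minor[of v] mult.commute)
    finally show ?thesis
      by (simp add: lessThan_Suc_atMost)
  qed
  from Cn C show ?thesis by blast
qed

lemma det_n_laplace_first_row:
  "det_n (Suc n) M = (\<Sum>j<Suc n. (-1) ^ j * M 0 j * det_n n (\<lambda>i k. M (Suc i) (if k < j then k else Suc k)))"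
proof -
  let ?A = "mat (Suc n) (Suc n) (\<lambda>(i, j). M i j)"
  have "mat_delete ?A 0 j = mat n n (\<lambda>(i, k). M (Suc i) (if k < j then k else Suc k))" for j
    unfolding mat_delete_def by (rule eq_matI) auto
  then show ?thesis
    unfolding det_n_def by (subst laplace_expansion_row[of _ "Suc n" 0]) (auto simp: cofactor_def intro!: sum.cong)
qed

lemma det_n_0: "det_n 0 M = 1"
  by (simp add: det_n_def)

lemma det_n_1: "det_n (Suc 0) M = M 0 0"
  by (simp add: det_n_laplace_first_row det_n_0)

lemma det_n_2: "det_n 2 M = M 0 0 * M 1 1 - M 0 1 * M 1 0"
  by (simp add: numeral_2_eq_2 det_n_laplace_first_row det_n_0)

lemma det_n_3:
  "det_n 3 M = M 0 0 * (M 1 1 * M 2 2 - M 1 2 * M 2 1) - M 0 1 * (M 1 0 * M 2 2 - M 1 2 * M 2 0)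
     + M 0 2 * (M 1 0 * M 2 1 - M 1 1 * M 2 0)"
  by (simp add: numeral_3_eq_3 numeral_2_eq_2 det_n_laplace_first_row det_n_0 algebra_simps)

text \<open>
  A row and a column of ones can be cleared by subtracting them, which lowers the size by one.
\<close>

lemma det_n_3_unit_border:
  assumes "\<And>i. M i 0 = 1" "\<And>j. M 0 j = 1"
  shows "det_n 3 M = (M 1 1 - 1) * (M 2 2 - 1) - (M 1 2 - 1) * (M 2 1 - 1)"
  by (simp add: numeral_3_eq_3 numeral_2_eq_2 det_n_laplace_first_row det_n_0 assms algebra_simps)

lemma det_n_4_unit_border:
  assumes "\<And>i. M i 0 = 1" "\<And>j. M 0 j = 1"
  shows "det_n 4 M = det_n 3 (\<lambda>i j. M (Suc i) (Suc j) - 1)"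
  by (simp add: numeral_eq_Suc numeral_3_eq_3 numeral_2_eq_2 det_n_laplace_first_row det_n_0 assms algebra_simps)

text \<open>
  The first-order term of a determinant at a singular matrix m, by the product rule applied to the
  Leibniz formula: one row at a time is replaced by the perturbation.
\<close>

lemma det_n_first_order:
  fixes \<rho> :: "real \<Rightarrow> nat \<Rightarrow> nat \<Rightarrow> real"
  assumes \<rho>: "\<And>a b. ((\<lambda>\<epsilon>. \<rho> \<epsilon> a b) \<longlongrightarrow> r a b) (at_right 0)" and "det_n n m = 0"
  shows "((\<lambda>\<epsilon>. det_n n (\<lambda>a b. m a b + \<epsilon> * \<rho> \<epsilon> a b) / \<epsilon>) \<longlongrightarrow>
     (\<Sum>c<n. det_n n (\<lambda>a b. if a = c then r a b else m a b))) (at_right 0)"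
proof -
  have entry: "((\<lambda>\<epsilon>. m a b + \<epsilon> * \<rho> \<epsilon> a b) has_field_derivative r a b) (at_right 0)" for a b
    unfolding has_field_derivative_iff using \<rho>[of a b]
    by (rule Lim_transform_eventually) (auto simp: eventually_at_filter)
  have product: "((\<lambda>\<epsilon>. \<Prod>i = 0..<n. m i (p i) + \<epsilon> * \<rho> \<epsilon> i (p i)) has_field_derivative
      (\<Sum>c\<in>{0..<n}. r c (p c) * (\<Prod>i\<in>{0..<n} - {c}. m i (p i)))) (at_right 0)" for p
    unfolding has_field_derivative_def
    by (rule has_derivative_eq_rhs[OF has_derivative_prod[OF entry[unfolded has_field_derivative_def]]])
       (auto simp: fun_eq_iff sum_distrib_left mult_ac)
  let ?P = "{p. p permutes {0..<n}}"
  have "((\<lambda>\<epsilon>. det_n n (\<lambda>a b. m a b + \<epsilon> * \<rho> \<epsilon> a b)) has_field_derivative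
      (\<Sum>p\<in>?P. signof p * (\<Sum>c\<in>{0..<n}. r c (p c) * (\<Prod>i\<in>{0..<n} - {c}. m i (p i))))) (at_right 0)"
    unfolding det_n_Leibniz
    by (intro DERIV_sum DERIV_cmult product)
  also have "(\<Sum>p\<in>?P. signof p * (\<Sum>c\<in>{0..<n}. r c (p c) * (\<Prod>i\<in>{0..<n} - {c}. m i (p i)))) =
     (\<Sum>c<n. det_n n (\<lambda>a b. if a = c then r a b else m a b))"
  proof -
    have "(\<Prod>i = 0..<n. if i = c then r i (p i) else m i (p i)) = r c (p c) * (\<Prod>i\<in>{0..<n} - {c}. m i (p i))"
      if "c < n" for c p
      using that by (subst prod.remove[of _ c]) (auto intro!: prod.cong)
    then show ?thesis
      unfolding det_n_Leibniz
      by (simp add: sum_distrib_left atLeast0LessThan) (rule sum.swap)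
  qed
  finally show ?thesis
    unfolding has_field_derivative_iff using assms(2) by simp
qed

section \<open>The exponential kernel\<close>

text \<open>
  A Chebyshev property, by induction on the number of terms: after division by one exponential,
  Rolle's theorem yields n - 1 zeros of a sum with one term less.
\<close>

lemma exp_sum_too_many_zeros:
  fixes c y z :: "nat \<Rightarrow> real"
  assumes "\<And>i. Suc i < n \<Longrightarrow> z i < z (Suc i)"
    and "inj_on y {..<n}"
    and "\<And>i. i < n \<Longrightarrow> (\<Sum>j<n. c j * exp (y j * z i)) = 0"
    and "j < n"
  shows "c j = 0"
  using assms
proof (induction n arbitrary: c y z j)
  case (Suc n)
  \<comment> \<open>Dividing by the last exponential makes its term constant, and differentiation removes it.\<close>
  define h where "h x = (\<Sum>j<Suc n. c j * exp ((y j - y n) * x))" for x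
  define h' where "h' x = (\<Sum>j<n. (c j * (y j - y n)) * exp ((y j - y n) * x))" for x
  have h: "h x = exp (- y n * x) * (\<Sum>j<Suc n. c j * exp (y j * x))" for x
    unfolding h_def sum_distrib_left by (intro sum.cong) (auto simp: algebra_simps simp flip: exp_add)
  have deriv: "(h has_real_derivative h' x) (at x)" for x
    unfolding h_def h'_def
    by (auto intro!: derivative_eq_intros sum.cong)
  have zero: "h (z i) = 0" if "i < Suc n" for i
    using Suc.prems(3)[OF that] by (simp only: h mult_zero_right)
  have "\<exists>\<xi>. z i < \<xi> \<and> \<xi> < z (Suc i) \<and> h' \<xi> = 0" if "i < n" for i
  proof -
    have "\<exists>\<xi>. z i < \<xi> \<and> \<xi> < z (Suc i) \<and> (*) (h' \<xi>) = (\<lambda>v. 0)"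
      using Suc.prems(1)[of i] that zero[of i] zero[of "Suc i"]
      by (intro Rolle_deriv[of "z i" "z (Suc i)" h "\<lambda>x. (*) (h' x)"])
         (auto intro!: continuous_at_imp_continuous_on DERIV_isCont deriv
            deriv[unfolded has_field_derivative_def])
    then obtain \<xi> where \<xi>: "z i < \<xi>" "\<xi> < z (Suc i)" and "(*) (h' \<xi>) = (\<lambda>v. 0)"
      by blast
    then have "h' \<xi> * 1 = 0"
      by (rule_tac fun_cong)
    with \<xi> show ?thesis
      by auto
  qed
  then obtain \<xi> where \<xi>: "z i < \<xi> i" "\<xi> i < z (Suc i)" "h' (\<xi> i) = 0" if "i < n" for i
    by metis
  have "\<xi> i < \<xi> (Suc i)" if "Suc i < n" for i
    using \<xi>(2)[of i] \<xi>(1)[of "Suc i"] that by linarith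
  then have "c j * (y j - y n) = 0" if "j < n" for j
    using Suc.prems(2) \<xi>(3) that
    by (intro Suc.IH[of \<xi> "\<lambda>j. y j - y n" "\<lambda>j. c j * (y j - y n)" j])
       (auto simp: inj_on_def h'_def)
  moreover have "y j \<noteq> y n" if "j < n" for j
    using Suc.prems(2) that by (auto simp: inj_on_def)
  ultimately have c: "c j = 0" if "j < n" for j
    using that by fastforce
  then have "h (z 0) = c n"
    unfolding h_def by simp
  with zero[of 0] c show ?case
    using Suc.prems(4) by (cases "j = n") auto
qed simp

text \<open>
  By induction on n. As a function of the last point, the determinant is an exponential sum whose
  leading coefficient is the smaller determinant. It is positive near infinity and cannot vanish from
  x n on, because it vanishes at the n earlier points.
\<close>

lemma det_exp_pos:
  fixes x y :: "nat \<Rightarrow> real"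
  assumes "\<And>i j. i < j \<Longrightarrow> j < n \<Longrightarrow> x i < x j" and "\<And>i j. i < j \<Longrightarrow> j < n \<Longrightarrow> y i < y j"
  shows "det_n n (\<lambda>i j. exp (x i * y j)) > 0"
  using assms
proof (induction n)
  case 0
  then show ?case by (simp add: det_n_def)
next
  case (Suc n)
  let ?E = "\<lambda>i j. exp (x i * y j)"
  obtain C where Cn: "C n = det_n n ?E"
    and C: "\<And>v. det_n (Suc n) (\<lambda>i. if i = n then v else ?E i) = (\<Sum>j\<le>n. C j * v j)"
    using det_n_laplace_last_row by blast
  define \<phi> where "\<phi> \<xi> = (\<Sum>j\<le>n. C j * exp (y j * \<xi>))" for \<xi>
  have Cpos: "C n > 0"
    unfolding Cn using Suc by simp
  have \<phi>_det: "\<phi> \<xi> = det_n (Suc n) (\<lambda>i. if i = n then \<lambda>j. exp (\<xi> * y j) else ?E i)" for \<xi>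
    unfolding C \<phi>_def by (simp add: mult.commute)
  have zeros: "\<phi> (x i) = 0" if "i < n" for i
    unfolding \<phi>_det by (rule det_n_equal_rows[of i _ n]) (use that in auto)
  have cont: "continuous_on A \<phi>" for A
    unfolding \<phi>_def by (intro continuous_intros)
  \<comment> \<open>The points x 0, ..., x (n - 1) already use up all the zeros that \<phi> may have.\<close>
  have no_zero: "\<phi> \<eta> \<noteq> 0" if "x n \<le> \<eta>" for \<eta>
  proof
    assume "\<phi> \<eta> = 0"
    have less: "i < n \<Longrightarrow> x i < \<eta>" for i
      using Suc.prems(1)[of i n] that by simp
    have "inj_on y {..<Suc n}"
    proof (rule inj_onI)
      fix i j assume "i \<in> {..<Suc n}" "j \<in> {..<Suc n}" "y i = y j"
      then show "i = j"
        using Suc.prems(2)[of i j] Suc.prems(2)[of j i] by (cases i j rule: linorder_cases) auto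
    qed
    then have "C n = 0"
      using \<open>\<phi> \<eta> = 0\<close> zeros less Suc.prems(1)
      by (intro exp_sum_too_many_zeros[of "Suc n" "\<lambda>i. if i = n then \<eta> else x i" y C])
         (auto simp: \<phi>_def lessThan_Suc_atMost)
    with Cpos show False by simp
  qed
  \<comment> \<open>For large \<xi> the term with the largest rate y n dominates, so \<phi> has the sign of C n.\<close>
  have "((\<lambda>\<xi>. \<Sum>j\<le>n. C j * exp ((y j - y n) * \<xi>)) \<longlongrightarrow> (\<Sum>j\<le>n. if j = n then C j else 0)) at_top"
  proof (intro tendsto_sum)
    fix j assume "j \<in> {..n}"
    show "((\<lambda>\<xi>. C j * exp ((y j - y n) * \<xi>)) \<longlongrightarrow> (if j = n then C j else 0)) at_top"
    proof (cases "j = n")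
      case False
      with \<open>j \<in> {..n}\<close> Suc.prems(2) have "y j - y n < 0" by simp
      then have "((\<lambda>\<xi>. C j * exp ((y j - y n) * \<xi>)) \<longlongrightarrow> C j * 0) at_top"
        by (intro tendsto_mult tendsto_const) real_asymp
      with False show ?thesis by simp
    qed simp
  qed
  then have "((\<lambda>\<xi>. \<Sum>j\<le>n. C j * exp ((y j - y n) * \<xi>)) \<longlongrightarrow> C n) at_top"
    by simp
  then have "\<forall>\<^sub>F \<xi> in at_top. (\<Sum>j\<le>n. C j * exp ((y j - y n) * \<xi>)) > 0"
    using Cpos by (rule order_tendstoD)
  then obtain \<xi> where \<xi>: "\<xi> \<ge> x n" "(\<Sum>j\<le>n. C j * exp ((y j - y n) * \<xi>)) > 0"
    using eventually_happens'[OF _ eventually_conj[OF eventually_ge_at_top[of "x n"]]] by fastforce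
  have "\<phi> \<xi> = exp (y n * \<xi>) * (\<Sum>j\<le>n. C j * exp ((y j - y n) * \<xi>))"
    unfolding \<phi>_def sum_distrib_left
    by (intro sum.cong) (auto simp: algebra_simps simp flip: exp_add)
  with \<xi> have pos: "\<phi> \<xi> > 0" by simp
  have "\<phi> (x n) > 0"
  proof (rule ccontr)
    assume "\<not> \<phi> (x n) > 0"
    then obtain \<eta> where "x n \<le> \<eta>" "\<eta> \<le> \<xi>" "\<phi> \<eta> = 0"
      using IVT'[of \<phi> "x n" 0 \<xi>] pos \<xi>(1) cont by auto
    with no_zero show False by blast
  qed
  then show ?case
    unfolding \<phi>_det
    by (subst det_n_cong[of "Suc n" _ "\<lambda>i. if i = n then \<lambda>j. exp (x n * y j) else ?E i"]) auto
qed

section \<open>Calculus of totally positive kernels\<close>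

lemma det_kernel_mat:
  assumes "length xs = r" "length ys = r"
  shows "det (kernel_mat K xs ys) = det_n r (\<lambda>i j. K (xs ! i) (ys ! j))"
  using assms by (simp add: kernel_mat_def det_n_def)

lemma incr_tuples_iff_nth:
  "xs \<in> incr_tuples r X \<longleftrightarrow>
     length xs = r \<and> (\<forall>i<r. xs ! i \<in> X) \<and> (\<forall>i j. i < j \<longrightarrow> j < r \<longrightarrow> xs ! i < xs ! j)"
  unfolding incr_tuples_def sorted_wrt_iff_nth_less subset_iff in_set_conv_nth by blast

lemma TP_I:
  assumes "\<And>r xs ys. 1 \<le> r \<Longrightarrow> enat r \<le> k \<Longrightarrow> xs \<in> incr_tuples r X \<Longrightarrow> ys \<in> incr_tuples r Y
    \<Longrightarrow> det_n r (\<lambda>i j. K (xs ! i) (ys ! j)) > 0"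
  shows "K \<in> TP X Y k"
  using assms unfolding TP_def by (auto simp: incr_tuples_iff_nth det_kernel_mat)

lemma TP_det_n_pos:
  assumes "K \<in> TP X Y k" "1 \<le> r" "enat r \<le> k" "xs \<in> incr_tuples r X" "ys \<in> incr_tuples r Y"
  shows "det_n r (\<lambda>i j. K (xs ! i) (ys ! j)) > 0"
  using TP_D[OF assms] assms(4,5) by (simp add: incr_tuples_iff_nth det_kernel_mat)

lemma TP_antimono: "k' \<le> k \<Longrightarrow> K \<in> TP X Y k \<Longrightarrow> K \<in> TP X Y k'"
  unfolding TP_def by auto

lemma TP_cong:
  assumes "K \<in> TP X Y k" "\<And>x y. x \<in> X \<Longrightarrow> y \<in> Y \<Longrightarrow> L x y = K x y"
  shows "L \<in> TP X Y k"
proof (rule TP_I)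
  fix r xs ys assume *: "1 \<le> r" "enat r \<le> k" "xs \<in> incr_tuples r X" "ys \<in> incr_tuples r Y"
  have "det_n r (\<lambda>i j. L (xs ! i) (ys ! j)) = det_n r (\<lambda>i j. K (xs ! i) (ys ! j))"
    using *(3,4) assms(2) by (intro det_n_cong) (auto simp: incr_tuples_iff_nth)
  then show "det_n r (\<lambda>i j. L (xs ! i) (ys ! j)) > 0"
    using TP_det_n_pos[OF assms(1) *] by simp
qed

lemma TP_scale:
  assumes "K \<in> TP X Y k" "\<And>x. x \<in> X \<Longrightarrow> a x > 0" "\<And>y. y \<in> Y \<Longrightarrow> b y > 0"
  shows "(\<lambda>x y. a x * b y * K x y) \<in> TP X Y k"
proof (rule TP_I)
  fix r xs ys assume *: "1 \<le> r" "enat r \<le> k" "xs \<in> incr_tuples r X" "ys \<in> incr_tuples r Y"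
  have "(\<Prod>i<r. a (xs ! i)) > 0" "(\<Prod>i<r. b (ys ! i)) > 0"
    using assms(2,3) *(3,4) by (auto intro!: prod_pos simp: incr_tuples_iff_nth)
  then show "det_n r (\<lambda>i j. a (xs ! i) * b (ys ! j) * K (xs ! i) (ys ! j)) > 0"
    using TP_det_n_pos[OF assms(1) *]
    by (simp add: det_n_scale[of r "\<lambda>i. a (xs ! i)" "\<lambda>j. b (ys ! j)"])
qed

lemma TP_transpose:
  assumes "K \<in> TP X Y k"
  shows "(\<lambda>y x. K x y) \<in> TP Y X k"
proof (rule TP_I)
  fix r xs ys assume *: "1 \<le> r" "enat r \<le> k" "xs \<in> incr_tuples r Y" "ys \<in> incr_tuples r X"
  then show "det_n r (\<lambda>i j. K (ys ! j) (xs ! i)) > 0"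
    using TP_det_n_pos[OF assms *(1,2,4,3)] det_n_transpose[of r "\<lambda>i j. K (ys ! i) (xs ! j)"] by simp
qed

lemma incr_tuples_map:
  "strict_mono_on X f \<Longrightarrow> f ` X \<subseteq> X' \<Longrightarrow> xs \<in> incr_tuples r X \<Longrightarrow> map f xs \<in> incr_tuples r X'"
  by (auto simp: incr_tuples_iff_nth strict_mono_on_def)

lemma TP_pullback:
  assumes "K \<in> TP X' Y' k" "strict_mono_on X f" "f ` X \<subseteq> X'" "strict_mono_on Y g" "g ` Y \<subseteq> Y'"
  shows "(\<lambda>x y. K (f x) (g y)) \<in> TP X Y k"
proof (rule TP_I)
  fix r xs ys assume *: "1 \<le> r" "enat r \<le> k" "xs \<in> incr_tuples r X" "ys \<in> incr_tuples r Y"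
  have "det_n r (\<lambda>i j. K (f (xs ! i)) (g (ys ! j))) = det_n r (\<lambda>i j. K (map f xs ! i) (map g ys ! j))"
    using *(3,4) by (intro det_n_cong) (auto simp: incr_tuples_iff_nth)
  also have "\<dots> > 0"
    by (intro TP_det_n_pos[OF assms(1) *(1,2)] incr_tuples_map[OF _ _ *(3)] incr_tuples_map[OF _ _ *(4)] assms)
  finally show "det_n r (\<lambda>i j. K (f (xs ! i)) (g (ys ! j))) > 0" .
qed

lemma TP_minor_2:
  assumes "K \<in> TP X Y k" "2 \<le> k" "x \<in> X" "x' \<in> X" "x < x'" "y \<in> Y" "y' \<in> Y" "y < y'"
  shows "K x y' * K x' y < K x y * K x' y'"
proof -
  have "det_n 2 (\<lambda>i j. K ([x, x'] ! i) ([y, y'] ! j)) > 0"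
    using assms by (intro TP_det_n_pos[OF assms(1)]) (auto simp: numeral_eq_enat incr_tuples_def)
  then show ?thesis by (simp add: det_n_2)
qed

lemma TP_1_iff: "K \<in> TP X Y 1 \<longleftrightarrow> (\<forall>x\<in>X. \<forall>y\<in>Y. K x y > 0)"
proof
  assume "K \<in> TP X Y 1"
  then show "\<forall>x\<in>X. \<forall>y\<in>Y. K x y > 0" using TP_pos[of K X Y 1] by simp
next
  assume *: "\<forall>x\<in>X. \<forall>y\<in>Y. K x y > 0"
  show "K \<in> TP X Y 1"
  proof (rule TP_I)
    fix r xs ys assume "1 \<le> r" "enat r \<le> 1" "xs \<in> incr_tuples r X" "ys \<in> incr_tuples r Y"
    moreover from this have "r = Suc 0" by (simp add: one_enat_def)
    ultimately show "det_n r (\<lambda>i j. K (xs ! i) (ys ! j)) > 0"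
      using * by (simp add: det_n_1 incr_tuples_iff_nth)
  qed
qed

lemma incr_tuples_le_ecard: "xs \<in> incr_tuples r X \<Longrightarrow> enat r \<le> ecard X"
proof -
  assume "xs \<in> incr_tuples r X"
  then have "card (set xs) = r" "set xs \<subseteq> X"
    by (auto simp: incr_tuples_def strict_sorted_iff distinct_card)
  then show ?thesis
    using card_mono[of X "set xs"] by (auto simp: ecard_def)
qed

lemma obtain_incr_tuple:
  assumes "enat n \<le> ecard X"
  obtains xs where "xs \<in> incr_tuples n X"
proof -
  obtain S where S: "S \<subseteq> X" "finite S" "card S = n"
    using assms obtain_subset_with_card_n[of n X] infinite_arbitrarily_large[of X n]
    unfolding ecard_def by (metis enat_ord_simps(1))
  then have "sorted_list_of_set S \<in> incr_tuples n X"
    by (auto simp: incr_tuples_def)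
  then show thesis by (rule that)
qed

lemma eff_order_ge_iff: "n \<le> eff_order X Y l \<longleftrightarrow> n \<le> ecard X \<and> n \<le> ecard Y \<and> n \<le> l"
  by (simp add: eff_order_def)

lemma obtain_incr_tuples_of_eff_order:
  assumes "enat n \<le> eff_order X Y l"
  obtains xs ys where "enat n \<le> l" "xs \<in> incr_tuples n X" "ys \<in> incr_tuples n Y"
  using obtain_incr_tuple[of n X] obtain_incr_tuple[of n Y] assms by (metis eff_order_ge_iff)

text \<open>
  Only minors of size at most the effective order can be tested.
\<close>

lemma incr_tuples_le_eff_order:
  assumes "enat r \<le> l" "xs \<in> incr_tuples r X" "ys \<in> incr_tuples r Y"
  shows "enat r \<le> eff_order X Y l"
  using assms incr_tuples_le_ecard[of xs r X] incr_tuples_le_ecard[of ys r Y] by (simp add: eff_order_def)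

lemma TP_up_to_2:
  assumes "eff_order X Y k \<le> 2"
    and "\<And>x y. x \<in> X \<Longrightarrow> y \<in> Y \<Longrightarrow> K x y > 0"
    and "\<And>x x' y y'. 2 \<le> k \<Longrightarrow> x \<in> X \<Longrightarrow> x' \<in> X \<Longrightarrow> x < x' \<Longrightarrow> y \<in> Y \<Longrightarrow> y' \<in> Y \<Longrightarrow> y < y'
           \<Longrightarrow> K x y' * K x' y < K x y * K x' y'"
  shows "K \<in> TP X Y k"
proof (rule TP_I)
  fix r xs ys assume *: "1 \<le> r" "enat r \<le> k" "xs \<in> incr_tuples r X" "ys \<in> incr_tuples r Y"
  then have "r = 1 \<or> r = 2"
    using order_trans[OF incr_tuples_le_eff_order[OF *(2-4)] assms(1)] by (auto simp: numeral_eq_enat)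
  then show "det_n r (\<lambda>i j. K (xs ! i) (ys ! j)) > 0"
    using * assms(2,3) by (auto simp: det_n_1 det_n_2 incr_tuples_iff_nth numeral_eq_enat)
qed

lemma TP_powr_up_to_2:
  assumes K: "K \<in> TP X Y k" "1 \<le> k" and "k \<le> 2" and "\<gamma> > 0"
  shows "(\<lambda>x y. K x y powr \<gamma>) \<in> TP X Y k"
proof (rule TP_up_to_2)
  have pos: "K x y > 0" if "x \<in> X" "y \<in> Y" for x y
    using TP_pos[OF K that] .
  show "eff_order X Y k \<le> 2"
    using assms(3) by (simp add: eff_order_def min.coboundedI2)
  show "K x y powr \<gamma> > 0" if "x \<in> X" "y \<in> Y" for x y
    using pos[OF that] by simp
  show "K x y' powr \<gamma> * K x' y powr \<gamma> < K x y powr \<gamma> * K x' y' powr \<gamma>"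
    if "2 \<le> k" "x \<in> X" "x' \<in> X" "x < x'" "y \<in> Y" "y' \<in> Y" "y < y'" for x x' y y'
    using TP_minor_2[OF K(1) that] pos that \<open>\<gamma> > 0\<close>
    by (simp add: powr_mult[symmetric] less_imp_le powr_less_mono2)
qed

lemma TP_exp: "(\<lambda>x y. exp (x * y)) \<in> TP UNIV UNIV k"
  by (rule TP_I, rule det_exp_pos) (auto simp: incr_tuples_iff_nth)

lemma TP_exponential_family:
  fixes f :: "'a::linorder \<Rightarrow> real"
  assumes "strict_mono p" "strict_mono_on X f"
  shows "(\<lambda>i x. exp (p i * f x)) \<in> TP (UNIV :: nat set) X k"
  using assms by (intro TP_pullback[OF TP_exp]) (auto simp: strict_mono_def strict_mono_on_def)

section \<open>Sums of products of totally positive families\<close>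

text \<open>
  The discrete Andreief identity, from which the Cauchy-Binet formula arises by collecting the index
  maps \<phi> with the same image. Summing over all maps needs no such bookkeeping: both sides are the
  same sum over pairs of permutations.
\<close>

lemma Andreief_identity:
  fixes u v :: "nat \<Rightarrow> nat \<Rightarrow> real"
  shows "fact r * det_n r (\<lambda>a b. \<Sum>i<m. u i a * v i b) =
    (\<Sum>\<phi>\<in>{0..<r} \<rightarrow>\<^sub>E {..<m}. det_n r (\<lambda>j. u (\<phi> j)) * det_n r (\<lambda>j. v (\<phi> j)))"
proof -
  let ?P = "{p. p permutes {0..<r}}"
  let ?W = "\<lambda>a b. \<Sum>i<m. u i a * v i b"
  have "(\<Sum>\<phi>\<in>{0..<r} \<rightarrow>\<^sub>E {..<m}. det_n r (\<lambda>j. u (\<phi> j)) * det_n r (\<lambda>j. v (\<phi> j))) =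
    (\<Sum>\<phi>\<in>{0..<r} \<rightarrow>\<^sub>E {..<m}. \<Sum>p\<in>?P. \<Sum>q\<in>?P. signof p * signof q *
       (\<Prod>j = 0..<r. u (\<phi> j) (p j) * v (\<phi> j) (q j)))"
    unfolding det_n_Leibniz sum_product by (simp add: prod.distrib mult_ac)
  also have "\<dots> = (\<Sum>p\<in>?P. \<Sum>q\<in>?P. \<Sum>\<phi>\<in>{0..<r} \<rightarrow>\<^sub>E {..<m}. signof p * signof q *
       (\<Prod>j = 0..<r. u (\<phi> j) (p j) * v (\<phi> j) (q j)))"
    by (subst sum.swap) (intro sum.cong refl sum.swap)
  also have "\<dots> = (\<Sum>p\<in>?P. \<Sum>q\<in>?P. signof p * signof q * (\<Prod>j = 0..<r. ?W (p j) (q j)))"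
    by (subst prod_sum_PiE) (auto simp: sum_distrib_left)
  \<comment> \<open>For each fixed p, substituting q o p for q turns the inner sum into the Leibniz formula.\<close>
  also have "\<dots> = (\<Sum>p\<in>?P. det_n r ?W)"
  proof (intro sum.cong refl)
    fix p assume "p \<in> ?P"
    then have p: "p permutes {0..<r}" by simp
    have "(\<Sum>q\<in>?P. signof p * signof q * (\<Prod>j = 0..<r. ?W (p j) (q j)))
      = (\<Sum>q\<in>?P. signof p * signof (q \<circ> p) * (\<Prod>j = 0..<r. ?W (p j) ((q \<circ> p) j)))"
      by (rule sum_permutations_compose_right[OF p])
    also have "\<dots> = (\<Sum>q\<in>?P. signof q * (\<Prod>j = 0..<r. ?W j (q j)))"
    proof (intro sum.cong refl)
      fix q assume "q \<in> ?P"
      then have q: "q permutes {0..<r}" by simp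
      have "signof p * signof (q \<circ> p) = (signof q :: real)"
        using signof_compose[OF q p, where 'a = real] signof_pm_one[of p, where 'a = real] by auto
      moreover have "(\<Prod>j = 0..<r. ?W (p j) ((q \<circ> p) j)) = (\<Prod>j = 0..<r. ?W j (q j))"
        using prod.permute[OF p, of "\<lambda>j. ?W j (q j)"] by (simp add: o_def)
      ultimately show "signof p * signof (q \<circ> p) * (\<Prod>j = 0..<r. ?W (p j) ((q \<circ> p) j))
        = signof q * (\<Prod>j = 0..<r. ?W j (q j))" by simp
    qed
    finally show "(\<Sum>q\<in>?P. signof p * signof q * (\<Prod>j = 0..<r. ?W (p j) (q j))) = det_n r ?W"
      by (simp add: det_n_Leibniz)
  qed
  also have "\<dots> = fact r * det_n r ?W"
    by (simp add: card_permutations)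
  finally show ?thesis by simp
qed

lemma obtain_sorting_permutation:
  fixes \<phi> :: "nat \<Rightarrow> nat"
  assumes "inj_on \<phi> {0..<r}"
  obtains p where "p permutes {0..<r}" "\<And>i j. i < j \<Longrightarrow> j < r \<Longrightarrow> \<phi> (p i) < \<phi> (p j)"
proof -
  define L where "L = sorted_list_of_set (\<phi> ` {0..<r})"
  have L: "sorted_wrt (<) L" "length L = r" "set L = \<phi> ` {0..<r}"
    using assms by (auto simp: L_def card_image)
  define p where "p j = (if j < r then inv_into {0..<r} \<phi> (L ! j) else j)" for j
  have in_im: "L ! j \<in> \<phi> ` {0..<r}" if "j < r" for j
    using L that nth_mem by blast
  have \<phi>p: "\<phi> (p j) = L ! j" if "j < r" for j
    using f_inv_into_f[OF in_im[OF that]] that by (simp add: p_def)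
  have less: "\<phi> (p i) < \<phi> (p j)" if "i < j" "j < r" for i j
    using that L by (simp add: \<phi>p sorted_wrt_iff_nth_less)
  have "inj_on p {0..<r}"
  proof (rule inj_onI)
    fix i j assume "i \<in> {0..<r}" "j \<in> {0..<r}" "p i = p j"
    then show "i = j"
      using less[of i j] less[of j i] by (cases i j rule: linorder_cases) auto
  qed
  moreover from this have "p ` {0..<r} = {0..<r}"
    using inv_into_into[OF in_im] by (intro endo_inj_surj) (auto simp: p_def)
  ultimately have "p permutes {0..<r}"
    by (intro bij_imp_permutes) (auto simp: bij_betw_def p_def)
  with less show thesis by (rule_tac that) auto
qed

text \<open>
  Sorting \<phi> changes both determinants by the same sign.
\<close>

lemma TP_minor_products_nonneg:
  fixes u :: "nat \<Rightarrow> 'a::linorder \<Rightarrow> real" and v :: "nat \<Rightarrow> 'b::linorder \<Rightarrow> real"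
  assumes u: "u \<in> TP UNIV X \<infinity>" and v: "v \<in> TP UNIV Y \<infinity>"
    and r: "1 \<le> r" and xs: "xs \<in> incr_tuples r X" and ys: "ys \<in> incr_tuples r Y"
  shows "det_n r (\<lambda>j a. u (\<phi> j) (xs ! a)) * det_n r (\<lambda>j b. v (\<phi> j) (ys ! b)) \<ge> 0"
proof (cases "inj_on \<phi> {0..<r}")
  case False
  then obtain i j where "i < r" "j < r" "i \<noteq> j" "\<phi> i = \<phi> j"
    by (auto simp: inj_on_def)
  then have "det_n r (\<lambda>j a. u (\<phi> j) (xs ! a)) = 0"
    by (intro det_n_equal_rows[of i _ j]) auto
  then show ?thesis by simp
next
  case True
  then obtain p where p: "p permutes {0..<r}" and less: "\<And>i j. i < j \<Longrightarrow> j < r \<Longrightarrow> \<phi> (p i) < \<phi> (p j)"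
    using obtain_sorting_permutation by metis
  have L: "map (\<phi> \<circ> p) [0..<r] \<in> incr_tuples r UNIV"
    by (auto simp: incr_tuples_iff_nth less)
  have "0 < det_n r (\<lambda>j a. u (map (\<phi> \<circ> p) [0..<r] ! j) (xs ! a)) *
           det_n r (\<lambda>j b. v (map (\<phi> \<circ> p) [0..<r] ! j) (ys ! b))"
    using TP_det_n_pos[OF u r _ L xs] TP_det_n_pos[OF v r _ L ys] by simp
  also have "\<dots> = det_n r (\<lambda>j a. u (\<phi> (p j)) (xs ! a)) * det_n r (\<lambda>j b. v (\<phi> (p j)) (ys ! b))"
    by (intro arg_cong2[of _ _ _ _ "(*)"] det_n_cong) auto
  also have "\<dots> = det_n r (\<lambda>j a. u (\<phi> j) (xs ! a)) * det_n r (\<lambda>j b. v (\<phi> j) (ys ! b))"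
    using det_n_permute_rows[OF p, of "\<lambda>j a. u (\<phi> j) (xs ! a)"]
      det_n_permute_rows[OF p, of "\<lambda>j b. v (\<phi> j) (ys ! b)"] signof_pm_one[of p, where 'a = real]
    by auto
  finally show ?thesis by simp
qed

lemma det_partial_sums_mono:
  fixes u :: "nat \<Rightarrow> 'a::linorder \<Rightarrow> real" and v :: "nat \<Rightarrow> 'b::linorder \<Rightarrow> real"
  assumes u: "u \<in> TP UNIV X \<infinity>" and v: "v \<in> TP UNIV Y \<infinity>"
    and r: "1 \<le> r" and xs: "xs \<in> incr_tuples r X" and ys: "ys \<in> incr_tuples r Y" and m: "m \<le> m'"
  shows "det_n r (\<lambda>a b. \<Sum>i<m. u i (xs ! a) * v i (ys ! b)) \<le>
         det_n r (\<lambda>a b. \<Sum>i<m'. u i (xs ! a) * v i (ys ! b))"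
proof -
  have "fact r * det_n r (\<lambda>a b. \<Sum>i<m. u i (xs ! a) * v i (ys ! b)) \<le>
      fact r * det_n r (\<lambda>a b. \<Sum>i<m'. u i (xs ! a) * v i (ys ! b))"
    unfolding Andreief_identity using m
    by (intro sum_mono2 PiE_mono finite_PiE TP_minor_products_nonneg[OF u v r xs ys]) auto
  then show ?thesis by simp
qed

text \<open>
  All terms of the Andreief identity are nonnegative, and the identity map gives a positive one.
\<close>

lemma TP_sum_of_products:
  fixes u :: "nat \<Rightarrow> 'a::linorder \<Rightarrow> real" and v :: "nat \<Rightarrow> 'b::linorder \<Rightarrow> real"
  assumes u: "u \<in> TP UNIV X \<infinity>" and v: "v \<in> TP UNIV Y \<infinity>"
  shows "(\<lambda>x y. \<Sum>i<m. u i x * v i y) \<in> TP X Y (enat m)"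
proof (rule TP_I)
  fix r xs ys assume r: "1 \<le> r" "enat r \<le> enat m" and xs: "xs \<in> incr_tuples r X" and ys: "ys \<in> incr_tuples r Y"
  define \<phi> where "\<phi> = restrict id {0..<r}"
  have \<phi>: "\<phi> \<in> {0..<r} \<rightarrow>\<^sub>E {..<m}"
    using r by (auto simp: \<phi>_def)
  have L: "[0..<r] \<in> incr_tuples r UNIV"
    by (auto simp: incr_tuples_iff_nth)
  have "0 < det_n r (\<lambda>j a. u ([0..<r] ! j) (xs ! a)) * det_n r (\<lambda>j b. v ([0..<r] ! j) (ys ! b))"
    using TP_det_n_pos[OF u r(1) _ L xs] TP_det_n_pos[OF v r(1) _ L ys] by simp
  also have "\<dots> = det_n r (\<lambda>j a. u (\<phi> j) (xs ! a)) * det_n r (\<lambda>j b. v (\<phi> j) (ys ! b))"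
    by (intro arg_cong2[of _ _ _ _ "(*)"] det_n_cong) (auto simp: \<phi>_def)
  finally have "0 < fact r * det_n r (\<lambda>a b. \<Sum>i<m. u i (xs ! a) * v i (ys ! b))"
    unfolding Andreief_identity using \<phi> TP_minor_products_nonneg[OF u v r(1) xs ys]
    by (intro sum_pos2[of _ \<phi>] finite_PiE) auto
  then show "0 < det_n r (\<lambda>a b. \<Sum>i<m. u i (xs ! a) * v i (ys ! b))"
    by (simp add: zero_less_mult_iff)
qed

text \<open>
  No index map into fewer than r values is injective; this is the statement that the kernel has rank
  at most m.
\<close>

lemma det_sum_of_few_products:
  fixes u v :: "nat \<Rightarrow> nat \<Rightarrow> real"
  assumes "m < r"
  shows "det_n r (\<lambda>a b. \<Sum>i<m. u i a * v i b) = 0"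
proof -
  have "det_n r (\<lambda>j. u (\<phi> j)) = 0" if "\<phi> \<in> {0..<r} \<rightarrow>\<^sub>E {..<m}" for \<phi>
  proof -
    have "\<not> inj_on \<phi> {0..<r}"
      using that assms card_inj_on_le[of \<phi> "{0..<r}" "{..<m}"] by (auto simp: PiE_iff)
    then obtain i j where "i < r" "j < r" "i \<noteq> j" "\<phi> i = \<phi> j"
      by (auto simp: inj_on_def)
    then show ?thesis
      by (intro det_n_equal_rows[of i _ j]) auto
  qed
  then have "fact r * det_n r (\<lambda>a b. \<Sum>i<m. u i a * v i b) = 0"
    unfolding Andreief_identity by (intro sum.neutral) auto
  then show ?thesis by simp
qed

text \<open>
  Minors of partial sums increase with the number of terms, so positivity survives the limit.
\<close>

lemma TP_series_of_products:
  fixes u :: "nat \<Rightarrow> 'a::linorder \<Rightarrow> real" and v :: "nat \<Rightarrow> 'b::linorder \<Rightarrow> real"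
  assumes u: "u \<in> TP UNIV X \<infinity>" and v: "v \<in> TP UNIV Y \<infinity>"
    and K: "\<And>x y. x \<in> X \<Longrightarrow> y \<in> Y \<Longrightarrow> (\<lambda>i. u i x * v i y) sums K x y"
  shows "K \<in> TP X Y k"
proof (rule TP_I)
  fix r xs ys assume r: "1 \<le> r" and xs: "xs \<in> incr_tuples r X" and ys: "ys \<in> incr_tuples r Y"
  let ?D = "\<lambda>m. det_n r (\<lambda>a b. \<Sum>i<m. u i (xs ! a) * v i (ys ! b))"
  have "?D \<longlonglongrightarrow> det_n r (\<lambda>a b. K (xs ! a) (ys ! b))"
    using K xs ys by (intro det_n_tendsto) (auto simp: incr_tuples_iff_nth sums_def)
  then have "?D r \<le> det_n r (\<lambda>a b. K (xs ! a) (ys ! b))"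
    by (rule tendsto_lowerbound)
       (auto intro!: det_partial_sums_mono[OF u v r xs ys] eventually_sequentiallyI[of r])
  moreover have "?D r > 0"
    using TP_det_n_pos[OF TP_sum_of_products[OF u v] r _ xs ys] by simp
  ultimately show "det_n r (\<lambda>a b. K (xs ! a) (ys ! b)) > 0" by simp
qed

section \<open>Order embeddings into the reals\<close>

lemma real_embeddings_of_TP:
  fixes X :: "'a::linorder set" and Y :: "'b::linorder set"
  assumes K: "K \<in> TP X Y k" "2 \<le> k" and "2 \<le> ecard X" "2 \<le> ecard Y"
  shows "\<exists>f :: 'a \<Rightarrow> real. strict_mono_on X f" "\<exists>g :: 'b \<Rightarrow> real. strict_mono_on Y g"
proof -
  obtain xs where "xs \<in> incr_tuples 2 X"
    using obtain_incr_tuple[of 2 X] assms(3) by (auto simp: numeral_eq_enat)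
  then have x: "xs ! 0 \<in> X" "xs ! 1 \<in> X" "xs ! 0 < xs ! 1"
    by (auto simp: incr_tuples_iff_nth)
  obtain ys where "ys \<in> incr_tuples 2 Y"
    using obtain_incr_tuple[of 2 Y] assms(4) by (auto simp: numeral_eq_enat)
  then have y: "ys ! 0 \<in> Y" "ys ! 1 \<in> Y" "ys ! 0 < ys ! 1"
    by (auto simp: incr_tuples_iff_nth)
  show "\<exists>f :: 'a \<Rightarrow> real. strict_mono_on X f"
    using TP_strict_mono_ratio[OF K y] by blast
  show "\<exists>g :: 'b \<Rightarrow> real. strict_mono_on Y g"
    using TP_strict_mono_ratio[OF TP_transpose[OF K(1)] K(2) x] by blast
qed

lemma strict_mono_on_interpolation:
  fixes X :: "'a::linorder set" and x :: "nat \<Rightarrow> 'a" and s :: "nat \<Rightarrow> real"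
  assumes "\<exists>f :: 'a \<Rightarrow> real. strict_mono_on X f"
    and "\<And>i. i < n \<Longrightarrow> x i \<in> X" "\<And>i j. i < j \<Longrightarrow> j < n \<Longrightarrow> x i < x j"
    and "\<And>i j. i < j \<Longrightarrow> j < n \<Longrightarrow> s i < s j"
  shows "\<exists>h. strict_mono_on X h \<and> (\<forall>i<n. h (x i) = s i)"
  using assms
proof (induction n)
  case (Suc n)
  then obtain h where h: "strict_mono_on X h" "\<And>i. i < n \<Longrightarrow> h (x i) = s i"
    by auto
  show ?case
  proof (cases n)
    case 0
    have "strict_mono_on X (\<lambda>z. h z + (s 0 - h (x 0)))"
      using h(1) by (auto simp: strict_mono_on_def)
    then show ?thesis
      using 0 by (intro exI[of _ "\<lambda>z. h z + (s 0 - h (x 0))"]) auto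
  next
    case (Suc m)
    \<comment> \<open>Keep h up to x m, and beyond it stretch h by the factor q that moves h (x n) to s n.\<close>
    define q where "q = (s n - s m) / (h (x n) - s m)"
    define h' where "h' z = (if z \<le> x m then h z else s m + (h z - s m) * q)" for z
    have xm: "x m \<in> X" "x n \<in> X" "x m < x n" "s m < s n" "h (x m) = s m"
      using Suc Suc.prems h(2) by auto
    have "h (x m) < h (x n)"
      using strict_mono_onD[OF h(1) xm(1,2,3)] .
    with xm have q: "q > 0" "(h (x n) - s m) * q = s n - s m"
      by (auto simp: q_def)
    have above: "h' z > s m" if "z \<in> X" "x m < z" for z
    proof -
      have "h z > s m"
        using strict_mono_onD[OF h(1) xm(1) that] xm by simp
      then show ?thesis
        using q that by (simp add: h'_def)
    qed
    have below: "h' z \<le> s m" if "z \<in> X" "z \<le> x m" for z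
      using strict_mono_on_leD[OF h(1) that(1) xm(1) that(2)] that xm by (simp add: h'_def)
    have "strict_mono_on X h'"
    proof (rule strict_mono_onI)
      fix z z' assume z: "z \<in> X" "z' \<in> X" "z < z'"
      then have "h z < h z'"
        using h(1) by (auto simp: strict_mono_on_def)
      then show "h' z < h' z'"
        using q z above[of z'] below[of z]
        by (cases "z \<le> x m"; cases "z' \<le> x m") (force simp: h'_def not_le)+
    qed
    moreover have "h' (x i) = s i" if "i < Suc n" for i
    proof (cases "i = n")
      case True
      then show ?thesis using xm q by (auto simp: h'_def)
    next
      case False
      then have "i < n" "i \<le> m"
        using that Suc by auto
      then have "x i \<le> x m"
        using Suc Suc.prems(3)[of i m] by (cases "i = m") auto
      then show ?thesis
        using h(2)[OF \<open>i < n\<close>] by (simp add: h'_def)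
    qed
    ultimately show ?thesis by blast
  qed
qed auto

lemma obtain_interpolating_embedding:
  fixes X :: "'a::linorder set" and s :: "nat \<Rightarrow> real"
  assumes "\<exists>f :: 'a \<Rightarrow> real. strict_mono_on X f" "xs \<in> incr_tuples n X"
    and "\<And>i j. i < j \<Longrightarrow> j < n \<Longrightarrow> s i < s j"
  obtains h where "strict_mono_on X h" "\<And>i. i < n \<Longrightarrow> h (xs ! i) = s i"
  using strict_mono_on_interpolation[of X n "(!) xs" s] assms by (auto simp: incr_tuples_iff_nth)

section \<open>Preservers are mixed powers\<close>

text \<open>
  The entrywise logarithm of a 2 x 2 matrix is A + B f + C g + D f g in coordinates f, g in {0, 1}; the
  condition on the determinant says that the coefficient D of the mixed term is positive.
\<close>

lemma obtain_TP_kernel_2x2: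
  fixes X :: "'a::linorder set" and Y :: "'b::linorder set"
  assumes "\<exists>f :: 'a \<Rightarrow> real. strict_mono_on X f" "\<exists>g :: 'b \<Rightarrow> real. strict_mono_on Y g"
    and "x1 \<in> X" "x2 \<in> X" "x1 < x2" "y1 \<in> Y" "y2 \<in> Y" "y1 < y2"
    and pos: "a > 0" "b > 0" "c > 0" "d > 0" and det: "b * c < a * d"
  obtains K where "K \<in> TP X Y \<infinity>" "K x1 y1 = a" "K x1 y2 = b" "K x2 y1 = c" "K x2 y2 = d"
proof -
  obtain f where f_mono: "strict_mono_on X f" and "\<And>i. i < 2 \<Longrightarrow> f ([x1, x2] ! i) = real i"
    by (rule obtain_interpolating_embedding[of X "[x1, x2]" 2 real])
       (use assms(1,3-5) in \<open>auto simp: incr_tuples_def\<close>)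
  from this(2)[of 0] this(2)[of 1] have f: "f x1 = 0" "f x2 = 1" by auto
  obtain g where g_mono: "strict_mono_on Y g" and "\<And>i. i < 2 \<Longrightarrow> g ([y1, y2] ! i) = real i"
    by (rule obtain_interpolating_embedding[of Y "[y1, y2]" 2 real])
       (use assms(2,6-8) in \<open>auto simp: incr_tuples_def\<close>)
  from this(2)[of 0] this(2)[of 1] have g: "g y1 = 0" "g y2 = 1" by auto
  define D where "D = ln (a * d / (b * c))"
  have "D > 0"
    using pos det by (simp add: D_def)
  then have "(\<lambda>x y. exp (D * f x * g y)) \<in> TP X Y \<infinity>"
    using f_mono g_mono by (intro TP_pullback[OF TP_exp]) (auto simp: strict_mono_on_def)
  then have "(\<lambda>x y. (a * exp (ln (c / a) * f x)) * exp (ln (b / a) * g y) * exp (D * f x * g y)) \<in> TP X Y \<infinity>"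
    using pos by (intro TP_scale) auto
  then show thesis
    by (rule that) (use pos in \<open>auto simp: f g D_def field_simps\<close>)
qed

lemma additive_nonneg_imp_linear:
  fixes h :: "real \<Rightarrow> real"
  assumes add: "\<And>x y. h (x + y) = h x + h y" and nonneg: "\<And>x. x \<ge> 0 \<Longrightarrow> h x \<ge> 0"
  shows "h x = h 1 * x"
proof -
  have zero: "h 0 = 0" using add[of 0 0] by simp
  have minus: "h (- x) = - h x" for x using add[of x "- x"] zero by simp
  have diff: "h (x - y) = h x - h y" for x y using add[of x "- y"] minus[of y] by simp
  have mono: "h x \<le> h y" if "x \<le> y" for x y using nonneg[of "y - x"] that diff[of y x] by simp
  have nat: "h (real n * x) = real n * h x" for n x
    by (induction n) (auto simp: zero add algebra_simps)
  have int: "h (of_int z) = of_int z * h 1" for z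
  proof (cases z)
    case (nonneg n)
    then show ?thesis using nat[of n 1] by simp
  next
    case (neg n)
    then have "real_of_int z = - real (Suc n)" by simp
    then show ?thesis using nat[of "Suc n" 1] minus[of "real (Suc n)"] by (simp del: of_nat_Suc)
  qed
  have "real n * \<bar>h x - h 1 * x\<bar> \<le> h 1" for n
  proof -
    let ?m = "\<lfloor>real n * x\<rfloor>"
    have "h (of_int ?m) \<le> h (real n * x)" "h (real n * x) \<le> h (of_int (?m + 1))"
      by (intro mono; linarith)+
    then have "of_int ?m * h 1 \<le> real n * h x" "real n * h x \<le> of_int ?m * h 1 + h 1"
      unfolding int nat by (simp_all add: algebra_simps)
    moreover have "of_int ?m * h 1 \<le> real n * x * h 1" "real n * x * h 1 \<le> (of_int ?m + 1) * h 1"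
      using nonneg[of 1] by (intro mult_right_mono; linarith)+
    ultimately have "\<bar>real n * h x - real n * x * h 1\<bar> \<le> h 1"
      by (simp add: algebra_simps abs_le_iff)
    moreover have "real n * h x - real n * x * h 1 = real n * (h x - h 1 * x)"
      by (simp add: algebra_simps)
    ultimately show ?thesis
      by (simp add: abs_mult)
  qed
  then have "\<bar>h x - h 1 * x\<bar> \<le> 0"
    using reals_Archimedean3[of "\<bar>h x - h 1 * x\<bar>"] by (metis linorder_not_le order.asym order_le_less_trans)
  then show ?thesis by simp
qed

text \<open>
  In logarithmic coordinates the hypothesis says that G b + G c < G a + G d as soon as b + c < a + d
  on J. Averaging over many steps along the diagonal shows that G has arbitrarily small increments, which
  turns strict inequalities into weak ones, hence equations of sums into equations of values. So G is affine; the strict inequality makes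
  its slopes nonnegative and at least one of them nonzero.
\<close>

lemma mixed_power_of_strict_exchange:
  fixes F :: "('p::finite \<Rightarrow> real) \<Rightarrow> real" and J :: "'p set"
  assumes Fpos: "\<And>t. t \<in> pos_orthant \<Longrightarrow> F t > 0"
    and exch: "\<And>a b c d. a \<in> pos_orthant \<Longrightarrow> b \<in> pos_orthant \<Longrightarrow> c \<in> pos_orthant \<Longrightarrow> d \<in> pos_orthant \<Longrightarrow>
       (\<And>j. j \<in> J \<Longrightarrow> b j * c j < a j * d j) \<Longrightarrow> F b * F c < F a * F d"
  shows "\<exists>c \<alpha>. c > 0 \<and> (\<forall>j. \<alpha> j \<ge> 0) \<and> (\<exists>j. \<alpha> j \<noteq> 0) \<and> (\<forall>j. j \<notin> J \<longrightarrow> \<alpha> j = 0) \<and>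
             (\<forall>t \<in> pos_orthant. F t = c * (\<Prod>j\<in>UNIV. t j powr \<alpha> j))"
proof -
  have ex: "(\<lambda>j. exp (u j)) \<in> pos_orthant" for u :: "'p \<Rightarrow> real"
    by (simp add: pos_orthant_def)
  define G where "G u = ln (F (\<lambda>j. exp (u j)))" for u
  have G: "F (\<lambda>j. exp (u j)) = exp (G u)" for u
    using Fpos[OF ex[of u]] by (simp add: G_def)
  have strict: "G b + G c < G a + G d" if "\<And>j. j \<in> J \<Longrightarrow> b j + c j < a j + d j" for a b c d
  proof -
    have "F (\<lambda>j. exp (b j)) * F (\<lambda>j. exp (c j)) < F (\<lambda>j. exp (a j)) * F (\<lambda>j. exp (d j))"
      using that by (intro exch ex) (simp flip: exp_add)
    then show ?thesis
      unfolding G by (simp flip: exp_add)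
  qed
  have small_step: "\<exists>\<epsilon>>0. G (\<lambda>j. b j + \<epsilon>) < G b + \<delta>" if \<delta>: "\<delta> > 0" for b \<delta>
  proof -
    \<comment> \<open>One of n equal steps of \<phi> on the unit interval rises by at most 1 / n of the total rise, and
      the exchange inequality carries that bound over to the base point b.\<close>
    define \<phi> where "\<phi> x = G (\<lambda>_. x)" for x
    obtain n where "max 0 (\<phi> 1 - \<phi> 0) < real n * \<delta>"
      using reals_Archimedean3[OF \<delta>] by blast
    then have n: "n > 0" "\<phi> 1 - \<phi> 0 < real n * \<delta>"
      by (auto intro: gr0I)
    have "\<exists>i<n. \<phi> (real (Suc i) / n) - \<phi> (real i / n) < \<delta>"
    proof (rule ccontr)
      assume "\<not> ?thesis"
      then have "(\<Sum>i<n. \<delta>) \<le> (\<Sum>i<n. \<phi> (real (Suc i) / n) - \<phi> (real i / n))"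
        by (intro sum_mono) (metis lessThan_iff not_less)
      also have "\<dots> = \<phi> 1 - \<phi> 0"
        using n(1) sum_lessThan_telescope[of "\<lambda>i. \<phi> (real i / n)" n] by simp
      finally show False using n by simp
    qed
    then obtain i where i: "\<phi> (real (Suc i) / n) - \<phi> (real i / n) < \<delta>" by blast
    have "G (\<lambda>j. b j + 1 / (2 * n)) + \<phi> (real i / n) < G b + \<phi> (real (Suc i) / n)"
      unfolding \<phi>_def using n(1) by (intro strict) (simp add: field_simps)
    with i n(1) show ?thesis
      by (intro exI[of _ "1 / (2 * real n)"]) auto
  qed
  have weak: "G b + G c \<le> G a + G d" if "\<And>j. j \<in> J \<Longrightarrow> b j + c j \<le> a j + d j" for a b c d
  proof (rule field_le_epsilon)
    fix \<delta> :: real assume "\<delta> > 0"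
    then obtain \<epsilon> where \<epsilon>: "\<epsilon> > 0" "G (\<lambda>j. a j + \<epsilon>) < G a + \<delta>"
      using small_step by blast
    have "G b + G c < G (\<lambda>j. a j + \<epsilon>) + G d"
      using that \<epsilon>(1) by (intro strict) fastforce
    with \<epsilon> show "G b + G c \<le> G a + G d + \<delta>" by simp
  qed
  have exact: "G b + G c = G a + G d" if "\<And>j. j \<in> J \<Longrightarrow> b j + c j = a j + d j" for a b c d
    using weak[of b c a d] weak[of a d b c] that by fastforce
  define z where "z = G (\<lambda>_. 0)"
  define L where "L j x = G (\<lambda>i. if i = j then x else 0) - z" for j x
  have sum: "G (\<lambda>i. if i \<in> A then u i else 0) - z = (\<Sum>j\<in>A. L j (u j))" for A u
  proof (induction A rule: finite_induct[OF finite])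
    case (2 j A)
    have "G (\<lambda>i. if i \<in> insert j A then u i else 0) + z =
        G (\<lambda>i. if i \<in> A then u i else 0) + G (\<lambda>i. if i = j then u j else 0)"
      unfolding z_def using 2(2) by (intro exact) auto
    then show ?case
      using 2 by (simp add: L_def)
  qed (simp add: z_def)
  define \<alpha> where "\<alpha> j = L j 1" for j
  have L_nonneg: "L j x \<ge> 0" if "x \<ge> 0" for j x
    using weak[of "\<lambda>_. 0" "\<lambda>_. 0" "\<lambda>i. if i = j then x else 0" "\<lambda>_. 0"] that by (simp add: L_def z_def)
  have L: "L j x = \<alpha> j * x" for j x
    unfolding \<alpha>_def
  proof (rule additive_nonneg_imp_linear)
    fix x y
    have "G (\<lambda>i. if i = j then x + y else 0) + G (\<lambda>_. 0) =
        G (\<lambda>i. if i = j then x else 0) + G (\<lambda>i. if i = j then y else 0)"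
      by (intro exact) auto
    then show "L j (x + y) = L j x + L j y"
      by (simp add: L_def z_def)
  qed (rule L_nonneg)
  have "\<alpha> j = 0" if "j \<notin> J" for j
  proof -
    have "G (\<lambda>i. if i = j then 1 else 0) + G (\<lambda>_. 0) = G (\<lambda>_. 0) + G (\<lambda>_. 0)"
      using that by (intro exact) auto
    then show ?thesis
      by (simp add: \<alpha>_def L_def z_def)
  qed
  moreover have "\<alpha> j \<ge> 0" for j
    unfolding \<alpha>_def by (rule L_nonneg) simp
  moreover have "\<exists>j. \<alpha> j \<noteq> 0"
  proof (rule ccontr)
    assume "\<not> ?thesis"
    then have "G (\<lambda>_. 1) = z"
      using sum[of UNIV "\<lambda>_. 1"] by (simp add: L)
    with strict[of "\<lambda>_. 0" "\<lambda>_. 0" "\<lambda>_. 1" "\<lambda>_. 0"] show False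
      by (simp add: z_def)
  qed
  moreover have "F t = exp z * (\<Prod>j\<in>UNIV. t j powr \<alpha> j)" if "t \<in> pos_orthant" for t
  proof -
    have t: "t j > 0" for j using that by (simp add: pos_orthant_def)
    then have "F t = exp (G (\<lambda>j. ln (t j)))"
      by (simp flip: G)
    also have "G (\<lambda>j. ln (t j)) = z + (\<Sum>j\<in>UNIV. \<alpha> j * ln (t j))"
      using sum[of UNIV "\<lambda>j. ln (t j)"] by (simp add: L)
    also have "exp \<dots> = exp z * (\<Prod>j\<in>UNIV. t j powr \<alpha> j)"
      using t by (simp add: exp_add exp_sum powr_def less_imp_neq[THEN not_sym])
    finally show ?thesis .
  qed
  ultimately show ?thesis
    by (intro exI[of _ "exp z"] exI[of _ \<alpha>]) auto
qed

lemma preserver_is_mixed_power: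
  fixes F :: "('p::finite \<Rightarrow> real) \<Rightarrow> real" and X :: "'a::linorder set" and Y :: "'b::linorder set"
  assumes pres: "preserves_TP X Y k l F" and k: "\<forall>j. 1 \<le> k j"
    and N: "2 \<le> eff_order X Y l"
    and K0: "\<forall>j. K0 j \<in> TP X Y (k j)"
    and F: "F \<in> pos_orthant \<rightarrow> {0<..}"
  shows "\<exists>c \<alpha>. c > 0 \<and> (\<forall>j. \<alpha> j \<ge> 0) \<and> (\<exists>j. \<alpha> j \<noteq> 0) \<and> (\<forall>j. k j < 2 \<longrightarrow> \<alpha> j = 0) \<and>
             (\<forall>t \<in> pos_orthant. F t = c * (\<Prod>j\<in>UNIV. t j powr \<alpha> j))"
proof -
  have card: "2 \<le> ecard X" "2 \<le> ecard Y" "2 \<le> l"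
    using N by (auto simp: eff_order_ge_iff)
  obtain xs where xs: "xs \<in> incr_tuples 2 X"
    using obtain_incr_tuple[of 2 X] card by (auto simp: numeral_eq_enat)
  then have x: "xs ! 0 \<in> X" "xs ! 1 \<in> X" "xs ! 0 < xs ! 1"
    by (auto simp: incr_tuples_iff_nth)
  obtain ys where ys: "ys \<in> incr_tuples 2 Y"
    using obtain_incr_tuple[of 2 Y] card by (auto simp: numeral_eq_enat)
  then have y: "ys ! 0 \<in> Y" "ys ! 1 \<in> Y" "ys ! 0 < ys ! 1"
    by (auto simp: incr_tuples_iff_nth)
  have "\<exists>c \<alpha>. c > 0 \<and> (\<forall>j. \<alpha> j \<ge> 0) \<and> (\<exists>j. \<alpha> j \<noteq> 0) \<and> (\<forall>j. j \<notin> {j. 2 \<le> k j} \<longrightarrow> \<alpha> j = 0) \<and>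
             (\<forall>t \<in> pos_orthant. F t = c * (\<Prod>j\<in>UNIV. t j powr \<alpha> j))"
  proof (rule mixed_power_of_strict_exchange)
    fix t :: "'p \<Rightarrow> real" assume "t \<in> pos_orthant"
    then show "F t > 0" using F by (auto simp: Pi_iff)
  next
    fix a b c d :: "'p \<Rightarrow> real"
    assume pos: "a \<in> pos_orthant" "b \<in> pos_orthant" "c \<in> pos_orthant" "d \<in> pos_orthant"
      and less: "\<And>j. j \<in> {j. 2 \<le> k j} \<Longrightarrow> b j * c j < a j * d j"
    \<comment> \<open>Every quadruple satisfying the hypothesis is a 2 x 2 submatrix of admissible kernels.\<close>
    have "\<exists>K. K \<in> TP X Y (k j) \<and> K (xs ! 0) (ys ! 0) = a j \<and> K (xs ! 0) (ys ! 1) = b j \<and>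
        K (xs ! 1) (ys ! 0) = c j \<and> K (xs ! 1) (ys ! 1) = d j" for j
    proof (cases "2 \<le> k j")
      case True
      have "\<exists>f :: 'a \<Rightarrow> real. strict_mono_on X f" "\<exists>g :: 'b \<Rightarrow> real. strict_mono_on Y g"
        using real_embeddings_of_TP[OF _ True card(1,2)] K0 by blast+
      then obtain K where "K \<in> TP X Y \<infinity>" "K (xs ! 0) (ys ! 0) = a j" "K (xs ! 0) (ys ! 1) = b j"
          "K (xs ! 1) (ys ! 0) = c j" "K (xs ! 1) (ys ! 1) = d j"
        using less[of j] pos True by (rule_tac obtain_TP_kernel_2x2[OF _ _ x y]) (auto simp: pos_orthant_def)
      then show ?thesis
        using TP_antimono[of "k j" \<infinity>] by auto
    next
      case False
      then have "k j = 1"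
        using k[rule_format, of j] by (cases "k j") (auto simp: numeral_eq_enat one_enat_def)
      then show ?thesis
        using pos x y
        by (intro exI[of _ "\<lambda>x y. if x = xs ! 0 then (if y = ys ! 0 then a j else b j)
                                  else (if y = ys ! 0 then c j else d j)"])
           (auto simp: TP_1_iff pos_orthant_def)
    qed
    then obtain K where K: "\<And>j. K j \<in> TP X Y (k j)" "\<And>j. K j (xs ! 0) (ys ! 0) = a j"
        "\<And>j. K j (xs ! 0) (ys ! 1) = b j" "\<And>j. K j (xs ! 1) (ys ! 0) = c j" "\<And>j. K j (xs ! 1) (ys ! 1) = d j"
      by metis
    have "compose_kernels F K \<in> TP X Y l"
      using pres K(1) by (auto simp: preserves_TP_def)
    from TP_minor_2[OF this card(3) x y] show "F b * F c < F a * F d"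
      by (simp add: compose_kernels_def K K[unfolded One_nat_def])
  qed
  then show ?thesis
    by (simp add: not_le)
qed

section \<open>Limits of totally positive kernels as test matrices\<close>

lemma three_powers_series_sums:
  fixes S T c1 c2 \<eta> :: real
  assumes P: "\<And>i. P (i + 3) = p + 1 + i" "P 0 = 0" "P 1 = p'" "P 2 = p"
    and Q: "\<And>i. Q (i + 3) = q + 1 + i" "Q 0 = 0" "Q 1 = q'" "Q 2 = q"
    and w: "\<And>i. w (i + 3) = \<eta> / fact i" "w 0 = 1" "w 1 = c1" "w 2 = c2"
  shows "(\<lambda>i. w i * S ^ P i * T ^ Q i) sums
    (1 + c1 * S ^ p' * T ^ q' + c2 * S ^ p * T ^ q + \<eta> * S ^ (p + 1) * T ^ (q + 1) * exp (S * T))"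
proof -
  have "(\<lambda>i. (S * T) ^ i /\<^sub>R fact i) sums exp (S * T)"
    by (rule exp_converges)
  then have "(\<lambda>i. \<eta> * S ^ (p + 1) * T ^ (q + 1) * ((S * T) ^ i /\<^sub>R fact i)) sums
      (\<eta> * S ^ (p + 1) * T ^ (q + 1) * exp (S * T))"
    by (rule sums_mult)
  moreover have "(\<lambda>i. \<eta> * S ^ (p + 1) * T ^ (q + 1) * ((S * T) ^ i /\<^sub>R fact i))
      = (\<lambda>i. w (i + 3) * S ^ P (i + 3) * T ^ Q (i + 3))"
    by (rule ext) (simp only: P Q w, simp add: power_add power_mult_distrib field_simps)
  moreover have "(\<Sum>i<3. w i * S ^ P i * T ^ Q i) = 1 + c1 * S ^ p' * T ^ q' + c2 * S ^ p * T ^ q"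
    using P(2-4) Q(2-4) w(2-4) by (simp add: numeral_3_eq_3 numeral_2_eq_2)
  ultimately show ?thesis
    by (subst sums_iff_shift'[of _ 3, symmetric]) (simp add: algebra_simps)
qed

text \<open>
  The tail of the series is summed in closed form, an exponential of exp f * exp g, so that it stays
  controlled when the weight \<eta> tends to 0.
\<close>

lemma TP_three_powers:
  fixes f :: "'a::linorder \<Rightarrow> real" and g :: "'b::linorder \<Rightarrow> real"
  assumes f: "strict_mono_on X f" and g: "strict_mono_on Y g"
    and "0 < p'" "p' < p" "0 < q'" "q' < q" "c1 > 0" "c2 > 0" "\<eta> > 0"
  shows "(\<lambda>x y. 1 + c1 * exp (f x) ^ p' * exp (g y) ^ q' + c2 * exp (f x) ^ p * exp (g y) ^ q
     + \<eta> * exp (f x) ^ (p + 1) * exp (g y) ^ (q + 1) * exp (exp (f x) * exp (g y))) \<in> TP X Y k"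
proof -
  define P where "P i = (if i = 0 then 0 else if i = 1 then p' else p + (i - 2))" for i :: nat
  define Q where "Q i = (if i = 0 then 0 else if i = 1 then q' else q + (i - 2))" for i :: nat
  define w where "w i = (if i = 0 then 1 else if i = 1 then c1 else if i = 2 then c2 else \<eta> / fact (i - 3))" for i :: nat
  have "strict_mono P" "strict_mono Q"
    using assms(3-6) by (auto simp: strict_mono_Suc_iff P_def Q_def)
  then have PQ: "strict_mono (\<lambda>i. real (P i))" "strict_mono (\<lambda>i. real (Q i))"
    by (simp_all add: strict_mono_def)
  have w: "w i > 0" for i
    using assms by (simp add: w_def)
  have u: "(\<lambda>i x. w i * 1 * exp (real (P i) * f x)) \<in> TP UNIV X \<infinity>"
    using w by (intro TP_scale TP_exponential_family PQ f) auto
  have v: "(\<lambda>i y. exp (real (Q i) * g y)) \<in> TP UNIV Y \<infinity>"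
    by (intro TP_exponential_family PQ g)
  show ?thesis
  proof (rule TP_series_of_products[OF u v])
    fix x y
    have "(\<lambda>i. w i * exp (f x) ^ P i * exp (g y) ^ Q i) sums
      (1 + c1 * exp (f x) ^ p' * exp (g y) ^ q' + c2 * exp (f x) ^ p * exp (g y) ^ q
        + \<eta> * exp (f x) ^ (p + 1) * exp (g y) ^ (q + 1) * exp (exp (f x) * exp (g y)))"
      by (rule three_powers_series_sums) (auto simp: P_def Q_def w_def)
    then show "(\<lambda>i. w i * 1 * exp (real (P i) * f x) * exp (real (Q i) * g y)) sums
      (1 + c1 * exp (f x) ^ p' * exp (g y) ^ q' + c2 * exp (f x) ^ p * exp (g y) ^ q
        + \<eta> * exp (f x) ^ (p + 1) * exp (g y) ^ (q + 1) * exp (exp (f x) * exp (g y)))"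
      by (simp add: exp_of_nat_mult)
  qed
qed

text \<open>
  Sharp test matrices have low rank or zero coordinates, so they are not submatrices of totally
  positive kernels but only limits of such submatrices.
\<close>

definition TP_approximable :: "'a::linorder set \<Rightarrow> 'b::linorder set \<Rightarrow> 'a list \<Rightarrow> 'b list \<Rightarrow> (nat \<Rightarrow> nat \<Rightarrow> real) \<Rightarrow> bool" where
  "TP_approximable X Y xs ys A \<longleftrightarrow> (\<exists>K. (\<forall>m. K m \<in> TP X Y \<infinity>) \<and>
     (\<forall>a<length xs. \<forall>b<length ys. (\<lambda>m. K m (xs ! a) (ys ! b)) \<longlonglongrightarrow> A a b))"

lemma TP_approximable_three_powers:
  fixes X :: "'a::linorder set" and Y :: "'b::linorder set"
  assumes X: "\<exists>f :: 'a \<Rightarrow> real. strict_mono_on X f" and Y: "\<exists>g :: 'b \<Rightarrow> real. strict_mono_on Y g"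
    and xs: "xs \<in> incr_tuples n X" and ys: "ys \<in> incr_tuples n Y"
    and pq: "0 < p'" "p' < p" "0 < q'" "q' < q" "c1 \<ge> 0" "c2 \<ge> 0"
  shows "TP_approximable X Y xs ys
     (\<lambda>a b. 1 + c1 * real a ^ p' * real b ^ q' + c2 * real a ^ p * real b ^ q)"
proof -
  \<comment> \<open>All coordinates a, b are raised by \<eta>, since logarithms need them positive, and so are the
    coefficients c1, c2; the tail of the series also gets the weight \<eta>.\<close>
  define \<eta> where "\<eta> m = inverse (real (Suc m))" for m
  have \<eta>: "\<eta> m > 0" for m by (simp add: \<eta>_def)
  have lim: "\<eta> \<longlonglongrightarrow> 0" unfolding \<eta>_def by (rule LIMSEQ_inverse_real_of_nat)
  have emb: "ln (real i + \<eta> m) < ln (real j + \<eta> m)" if "i < j" for i j m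
    using that \<eta>[of m] by (subst ln_less_cancel_iff) auto
  have "\<exists>f. strict_mono_on X f \<and> (\<forall>i<n. f (xs ! i) = ln (real i + \<eta> m))" for m
    by (rule obtain_interpolating_embedding[OF X xs, of "\<lambda>i. ln (real i + \<eta> m)"]) (auto intro: emb)
  then obtain f where f: "\<And>m. strict_mono_on X (f m)" "\<And>m i. i < n \<Longrightarrow> f m (xs ! i) = ln (real i + \<eta> m)"
    by metis
  have "\<exists>g. strict_mono_on Y g \<and> (\<forall>i<n. g (ys ! i) = ln (real i + \<eta> m))" for m
    by (rule obtain_interpolating_embedding[OF Y ys, of "\<lambda>i. ln (real i + \<eta> m)"]) (auto intro: emb)
  then obtain g where g: "\<And>m. strict_mono_on Y (g m)" "\<And>m i. i < n \<Longrightarrow> g m (ys ! i) = ln (real i + \<eta> m)"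
    by metis
  define R where "R e S T = 1 + (c1 + e) * S ^ p' * T ^ q' + (c2 + e) * S ^ p * T ^ q
     + e * S ^ (p + 1) * T ^ (q + 1) * exp (S * T)" for e S T :: real
  have "(\<lambda>x y. R (\<eta> m) (exp (f m x)) (exp (g m y))) \<in> TP X Y \<infinity>" for m
    unfolding R_def using pq \<eta>[of m] by (intro TP_three_powers f g) auto
  moreover have "(\<lambda>m. R (\<eta> m) (exp (f m (xs ! a))) (exp (g m (ys ! b)))) \<longlonglongrightarrow>
      1 + c1 * real a ^ p' * real b ^ q' + c2 * real a ^ p * real b ^ q" if "a < n" "b < n" for a b
  proof -
    have "(\<lambda>m. R (\<eta> m) (exp (f m (xs ! a))) (exp (g m (ys ! b)))) = (\<lambda>m. R (\<eta> m) (real a + \<eta> m) (real b + \<eta> m))"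
      using that \<eta> by (simp add: f g add_nonneg_pos)
    moreover have "(\<lambda>m. R (\<eta> m) (real a + \<eta> m) (real b + \<eta> m)) \<longlonglongrightarrow> R 0 (real a + 0) (real b + 0)"
      unfolding R_def by (intro tendsto_intros lim)
    ultimately show ?thesis
      by (simp add: R_def)
  qed
  ultimately show ?thesis
    unfolding TP_approximable_def using xs ys
    by (intro exI[of _ "\<lambda>m x y. R (\<eta> m) (exp (f m x)) (exp (g m y))"]) (auto simp: incr_tuples_iff_nth)
qed

text \<open>
  A preserver of the form considered here is continuous, so strict positivity of the minors becomes
  nonnegativity in the limit.
\<close>

lemma det_of_approximable_nonneg:
  fixes F :: "('p::finite \<Rightarrow> real) \<Rightarrow> real"
  assumes pres: "preserves_TP X Y k l F" and k: "\<forall>j. 1 \<le> k j"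
    and F: "c > 0" "\<And>t. t \<in> pos_orthant \<Longrightarrow> F t = c * (\<Prod>j\<in>UNIV. t j powr \<alpha> j)"
    and n: "1 \<le> n" "enat n \<le> l" and xs: "xs \<in> incr_tuples n X" and ys: "ys \<in> incr_tuples n Y"
    and A: "\<And>j. TP_approximable X Y xs ys (A j)" "\<And>j a b. A j a b > 0"
  shows "det_n n (\<lambda>a b. \<Prod>j\<in>UNIV. A j a b powr \<alpha> j) \<ge> 0"
proof -
  from A(1) obtain K where K: "\<And>j m. K j m \<in> TP X Y \<infinity>"
    and lim: "\<And>j a b. a < n \<Longrightarrow> b < n \<Longrightarrow> (\<lambda>m. K j m (xs ! a) (ys ! b)) \<longlonglongrightarrow> A j a b"
    using xs ys unfolding TP_approximable_def by (simp add: incr_tuples_iff_nth) metis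
  have Kpos: "K j m x y > 0" if "x \<in> X" "y \<in> Y" for j m x y
    using TP_pos[OF K] that by simp
  let ?P = "\<lambda>m x y. \<Prod>j\<in>UNIV. K j m x y powr \<alpha> j"
  have "det_n n (\<lambda>a b. ?P m (xs ! a) (ys ! b)) > 0" for m
  proof -
    have "compose_kernels F (\<lambda>j. K j m) \<in> TP X Y l"
      using pres TP_antimono[OF _ K] unfolding preserves_TP_def by simp
    then have "(\<lambda>x y. c * ?P m x y) \<in> TP X Y l"
      by (rule TP_cong) (use Kpos in \<open>auto simp: compose_kernels_def F(2) pos_orthant_def\<close>)
    then have "(\<lambda>x y. inverse c * 1 * (c * ?P m x y)) \<in> TP X Y l"
      using F(1) by (intro TP_scale) auto
    then have "?P m \<in> TP X Y l"
      using F(1) by (simp add: mult.assoc[symmetric])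
    then show ?thesis
      by (rule TP_det_n_pos[OF _ n xs ys])
  qed
  moreover have "(\<lambda>m. det_n n (\<lambda>a b. ?P m (xs ! a) (ys ! b))) \<longlonglongrightarrow> det_n n (\<lambda>a b. \<Prod>j\<in>UNIV. A j a b powr \<alpha> j)"
    using A(2) by (intro det_n_tendsto tendsto_prod tendsto_powr lim tendsto_const) (auto simp: less_imp_neq[symmetric])
  ultimately show ?thesis
    by (intro tendsto_lowerbound[of _ _ sequentially 0]) (auto simp: less_imp_le)
qed

text \<open>
  The constant matrix 1 is among the test matrices, so all but one or two arguments can be switched
  off.
\<close>

lemma det_single_factor_nonneg:
  fixes F :: "('p::finite \<Rightarrow> real) \<Rightarrow> real" and X :: "'a::linorder set" and Y :: "'b::linorder set"
  assumes pres: "preserves_TP X Y k l F" and k: "\<forall>j. 1 \<le> k j"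
    and F: "c > 0" "\<And>t. t \<in> pos_orthant \<Longrightarrow> F t = c * (\<Prod>j\<in>UNIV. t j powr \<alpha> j)"
    and X: "\<exists>f :: 'a \<Rightarrow> real. strict_mono_on X f" and Y: "\<exists>g :: 'b \<Rightarrow> real. strict_mono_on Y g"
    and n: "1 \<le> n" "enat n \<le> l" and xs: "xs \<in> incr_tuples n X" and ys: "ys \<in> incr_tuples n Y"
    and pq: "0 < p'" "p' < p" "0 < q'" "q' < q" "c1 \<ge> 0" "c2 \<ge> 0"
  shows "det_n n (\<lambda>a b. (1 + c1 * real a ^ p' * real b ^ q' + c2 * real a ^ p * real b ^ q) powr \<alpha> i) \<ge> 0"
proof -
  have const: "TP_approximable X Y xs ys (\<lambda>a b. 1)"
    using TP_approximable_three_powers[OF X Y xs ys, of 1 2 1 2 0 0] by simp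
  define M where "M a b = 1 + c1 * real a ^ p' * real b ^ q' + c2 * real a ^ p * real b ^ q" for a b
  have M: "TP_approximable X Y xs ys M"
    unfolding M_def by (rule TP_approximable_three_powers[OF X Y xs ys pq])
  have Mpos: "M a b > 0" for a b
    unfolding M_def using pq by (intro add_pos_nonneg) auto
  have "det_n n (\<lambda>a b. \<Prod>j\<in>UNIV. (if j = i then M else (\<lambda>a b. 1)) a b powr \<alpha> j) \<ge> 0"
    by (rule det_of_approximable_nonneg[OF pres k F n xs ys]) (use const M Mpos in auto)
  moreover have "(\<Prod>j\<in>UNIV. (if j = i then M else (\<lambda>a b. 1)) a b powr \<alpha> j) = M a b powr \<alpha> i" for a b
    by (subst prod.remove[of _ i]) auto
  ultimately show ?thesis
    by (simp add: M_def)
qed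

lemma det_two_factors_nonneg:
  fixes F :: "('p::finite \<Rightarrow> real) \<Rightarrow> real" and X :: "'a::linorder set" and Y :: "'b::linorder set"
  assumes pres: "preserves_TP X Y k l F" and k: "\<forall>j. 1 \<le> k j"
    and F: "c > 0" "\<And>t. t \<in> pos_orthant \<Longrightarrow> F t = c * (\<Prod>j\<in>UNIV. t j powr \<alpha> j)"
    and X: "\<exists>f :: 'a \<Rightarrow> real. strict_mono_on X f" and Y: "\<exists>g :: 'b \<Rightarrow> real. strict_mono_on Y g"
    and n: "1 \<le> n" "enat n \<le> l" and xs: "xs \<in> incr_tuples n X" and ys: "ys \<in> incr_tuples n Y"
    and "p > 0" "q > 0" "p' > 0" "q' > 0" "\<epsilon> \<ge> 0" and "i \<noteq> i'"
  shows "det_n n (\<lambda>a b. (1 + \<epsilon> * (real a ^ p * real b ^ q)) powr \<alpha> i *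
                        (1 + \<epsilon> * (real a ^ p' * real b ^ q')) powr \<alpha> i') \<ge> 0"
proof -
  define M where "M p q = (\<lambda>a b. 1 + \<epsilon> * (real a ^ p * real b ^ q))" for p q
  have M: "TP_approximable X Y xs ys (M p q)" if "p > 0" "q > 0" for p q
    using TP_approximable_three_powers[OF X Y xs ys that(1) lessI that(2) lessI assms(15) order_refl]
    by (simp add: M_def mult.assoc)
  have const: "TP_approximable X Y xs ys (\<lambda>a b. 1)"
    using TP_approximable_three_powers[OF X Y xs ys, of 1 2 1 2 0 0] by simp
  have Mpos: "M p q a b > 0" for p q a b
    unfolding M_def using assms(15) by (intro add_pos_nonneg) auto
  have "det_n n (\<lambda>a b. \<Prod>j\<in>UNIV. (if j = i then M p q else if j = i' then M p' q' else (\<lambda>a b. 1)) a b powr \<alpha> j) \<ge> 0"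
    by (rule det_of_approximable_nonneg[OF pres k F n xs ys]) (use const M Mpos assms(11-14) in auto)
  moreover have "(\<Prod>j\<in>UNIV. (if j = i then M p q else if j = i' then M p' q' else (\<lambda>a b. 1)) a b powr \<alpha> j)
      = M p q a b powr \<alpha> i * M p' q' a b powr \<alpha> i'" for a b
    using \<open>i \<noteq> i'\<close> by (subst prod.remove[of _ i], simp, simp, subst prod.remove[of _ i']) auto
  ultimately show ?thesis
    by (simp add: M_def)
qed

section \<open>Determinants that restrict the exponents\<close>

lemma powr_second_order:
  fixes m \<alpha> :: real
  shows "((\<lambda>\<epsilon>. (((1 + \<epsilon> * m) powr \<alpha> - 1) / \<epsilon> - \<alpha> * m) / \<epsilon>) \<longlongrightarrow> \<alpha> * (\<alpha> - 1) / 2 * m\<^sup>2) (at_right 0)"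
proof -
  have "((\<lambda>\<epsilon>. (((1 + \<epsilon> * m) powr \<alpha> - 1) / \<epsilon> - \<alpha> * m) / \<epsilon>) \<longlongrightarrow> m * (m * ((\<alpha> - 1) * \<alpha>)) / 2) (at_right 0)"
    by real_asymp
  then show ?thesis
    by (simp add: power2_eq_square mult_ac)
qed

lemma powr_product_first_order:
  fixes m m' \<alpha> \<beta> :: real
  shows "((\<lambda>\<epsilon>. ((1 + \<epsilon> * m) powr \<alpha> * (1 + \<epsilon> * m') powr \<beta> - 1) / \<epsilon>) \<longlongrightarrow> \<alpha> * m + \<beta> * m') (at_right 0)"
  by real_asymp

lemma exponent_ge_1_of_order_3:
  assumes "\<beta> > 0"
    and det: "\<And>\<epsilon>. \<epsilon> > 0 \<Longrightarrow> det_n 3 (\<lambda>a b. (1 + \<epsilon> * (real a * real b)) powr \<beta>) \<ge> 0"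
  shows "\<beta> \<ge> 1"
proof (rule ccontr)
  assume "\<not> \<beta> \<ge> 1"
  \<comment> \<open>Row and column 0 are constant 1, so only the block with indices 1 and 2 matters. To first order
    it is the rank-one matrix m, hence the quadratic term of the power decides the sign.\<close>
  define m where "m a b = real (Suc a) * real (Suc b)" for a b
  define \<rho> where "\<rho> \<epsilon> a b = (((1 + \<epsilon> * m a b) powr \<beta> - 1) / \<epsilon> - \<beta> * m a b) / \<epsilon>" for \<epsilon> a b
  have "((\<lambda>\<epsilon>. det_n 2 (\<lambda>a b. \<beta> * m a b + \<epsilon> * \<rho> \<epsilon> a b) / \<epsilon>) \<longlongrightarrow>
      (\<Sum>c<2. det_n 2 (\<lambda>a b. if a = c then \<beta> * (\<beta> - 1) / 2 * (m a b)\<^sup>2 else \<beta> * m a b))) (at_right 0)"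
    unfolding \<rho>_def by (intro det_n_first_order powr_second_order) (simp add: det_n_2 m_def)
  moreover have "(\<Sum>c<2. det_n 2 (\<lambda>a b. if a = c then \<beta> * (\<beta> - 1) / 2 * (m a b)\<^sup>2 else \<beta> * m a b))
      = 2 * (\<beta>\<^sup>2 * (\<beta> - 1))"
  proof -
    have two: "{..<2::nat} = {0, 1}" by auto
    show ?thesis
      by (simp add: two det_n_2 m_def) (simp add: field_simps power2_eq_square)
  qed
  moreover have "det_n 2 (\<lambda>a b. \<beta> * m a b + \<epsilon> * \<rho> \<epsilon> a b) / \<epsilon> \<ge> 0" if "\<epsilon> > 0" for \<epsilon>
  proof -
    have "\<beta> * m a b + \<epsilon> * \<rho> \<epsilon> a b = ((1 + \<epsilon> * m a b) powr \<beta> - 1) / \<epsilon>" for a b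
      using that by (simp add: \<rho>_def)
    then have "det_n 2 (\<lambda>a b. \<beta> * m a b + \<epsilon> * \<rho> \<epsilon> a b) =
        det_n 2 (\<lambda>a b. ((1 + \<epsilon> * m a b) powr \<beta> - 1) / \<epsilon>)"
      by (simp only:)
    also have "\<dots> = det_n 3 (\<lambda>a b. (1 + \<epsilon> * (real a * real b)) powr \<beta>) / \<epsilon>\<^sup>2"
      using that by (simp add: det_n_2 det_n_3_unit_border m_def field_simps power2_eq_square)
    finally show ?thesis
      using det[OF that] that by simp
  qed
  ultimately have "2 * (\<beta>\<^sup>2 * (\<beta> - 1)) \<ge> 0"
    by (intro tendsto_lowerbound[of _ _ "at_right 0" 0]) (auto simp: eventually_at_right_less intro!: eventually_at_rightI[of 0 1])
  then show False
    using \<open>\<beta> > 0\<close> \<open>\<not> \<beta> \<ge> 1\<close> by (auto simp: zero_le_mult_iff)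
qed

text \<open>
  The exponents of the two rank-one perturbations are ordered oppositely in a and b, so the
  first-order term, their weighted sum, has the negative determinant - 4 \<alpha> \<beta>.
\<close>

lemma no_two_exponents_of_order_3:
  assumes "\<alpha> > 0" "\<beta> > 0"
    and det: "\<And>\<epsilon>. \<epsilon> > 0 \<Longrightarrow> det_n 3 (\<lambda>a b. (1 + \<epsilon> * (real a ^ 1 * real b ^ 2)) powr \<alpha> *
       (1 + \<epsilon> * (real a ^ 2 * real b ^ 1)) powr \<beta>) \<ge> 0"
  shows False
proof -
  define M where "M \<epsilon> a b = (1 + \<epsilon> * (real a * real b ^ 2)) powr \<alpha> * (1 + \<epsilon> * (real a ^ 2 * real b)) powr \<beta>" for \<epsilon> a b
  define m where "m a b = \<alpha> * (real a * real b ^ 2) + \<beta> * (real a ^ 2 * real b)" for a b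
  have "((\<lambda>\<epsilon>. (M \<epsilon> a b - 1) / \<epsilon>) \<longlongrightarrow> m a b) (at_right 0)" for a b
    unfolding M_def m_def by (rule powr_product_first_order)
  then have "((\<lambda>\<epsilon>. det_n 2 (\<lambda>a b. (M \<epsilon> (Suc a) (Suc b) - 1) / \<epsilon>)) \<longlongrightarrow> det_n 2 (\<lambda>a b. m (Suc a) (Suc b))) (at_right 0)"
    by (intro det_n_tendsto)
  moreover have "det_n 2 (\<lambda>a b. (M \<epsilon> (Suc a) (Suc b) - 1) / \<epsilon>) \<ge> 0" if "\<epsilon> > 0" for \<epsilon>
  proof -
    have "M \<epsilon> i 0 = 1" "M \<epsilon> 0 i = 1" for i
      by (simp_all add: M_def)
    then have "det_n 3 (M \<epsilon>) = \<epsilon>\<^sup>2 * det_n 2 (\<lambda>a b. (M \<epsilon> (Suc a) (Suc b) - 1) / \<epsilon>)"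
      using that unfolding det_n_2 by (subst det_n_3_unit_border) (simp_all add: numeral_2_eq_2 field_simps)
    moreover have "det_n 3 (M \<epsilon>) \<ge> 0"
      unfolding M_def[abs_def] using det[OF that] by simp
    ultimately show ?thesis
      using that by (simp only: zero_le_mult_iff) simp
  qed
  ultimately have "det_n 2 (\<lambda>a b. m (Suc a) (Suc b)) \<ge> 0"
    by (intro tendsto_lowerbound[of _ _ "at_right 0" 0]) (auto intro!: eventually_at_rightI[of 0 1])
  moreover have "det_n 2 (\<lambda>a b. m (Suc a) (Suc b)) = - 4 * (\<alpha> * \<beta>)"
    by (simp add: det_n_2 m_def algebra_simps power2_eq_square)
  ultimately show False
    using assms(1,2) by (simp add: mult_le_0_iff)
qed

text \<open>
  The perturbation has rank two, so its 3 x 3 determinant vanishes and the quadratic term of the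
  power decides. It has the sign of \<beta> - 1 times that of a determinant which involves the entrywise
  square of the perturbation and is made negative by the choice of the exponents.
\<close>

lemma exponent_le_1_of_order_4:
  assumes "\<beta> > 0"
    and det: "\<And>\<epsilon>. \<epsilon> > 0 \<Longrightarrow> det_n 4 (\<lambda>a b. (1 + \<epsilon> * (1000 * real a * real b ^ 2 + real a ^ 3 * real b ^ 3)) powr \<beta>) \<ge> 0"
  shows "\<beta> \<le> 1"
proof (rule ccontr)
  assume "\<not> \<beta> \<le> 1"
  \<comment> \<open>The block with indices 1, 2, 3 of the perturbation. The limit computed below is dominated by
    the contribution det(a, a^3, a^2) * det(b^2, b^3, b^4) = (- 12) * 72 of the term a^2 * b^4 of m^2
    (a, b = 1, 2, 3); the weight 1000 makes the remaining contributions small.\<close>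
  define m where "m a b = 1000 * real (Suc a) * real (Suc b) ^ 2 + real (Suc a) ^ 3 * real (Suc b) ^ 3" for a b
  define \<rho> where "\<rho> \<epsilon> a b = (((1 + \<epsilon> * m a b) powr \<beta> - 1) / \<epsilon> - \<beta> * m a b) / \<epsilon>" for \<epsilon> a b
  have m: "m 0 0 = 1001" "m 0 1 = 4008" "m 0 2 = 9027" "m 1 0 = 2008" "m 1 1 = 8064" "m 1 2 = 18216"
    "m 2 0 = 3027" "m 2 1 = 12216" "m 2 2 = 27729"
    by (simp_all add: m_def)
  have "((\<lambda>\<epsilon>. det_n 3 (\<lambda>a b. \<beta> * m a b + \<epsilon> * \<rho> \<epsilon> a b) / \<epsilon>) \<longlongrightarrow>
      (\<Sum>c<3. det_n 3 (\<lambda>a b. if a = c then \<beta> * (\<beta> - 1) / 2 * (m a b)\<^sup>2 else \<beta> * m a b))) (at_right 0)"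
    unfolding \<rho>_def by (intro det_n_first_order powr_second_order) (simp add: det_n_3 m[unfolded One_nat_def])
  moreover have "(\<Sum>c<3. det_n 3 (\<lambda>a b. if a = c then \<beta> * (\<beta> - 1) / 2 * (m a b)\<^sup>2 else \<beta> * m a b))
      = - 372394800000 * (\<beta> ^ 3 * (\<beta> - 1))"
  proof -
    have three: "{..<3::nat} = {0, 1, 2}" by auto
    show ?thesis
      by (simp add: three det_n_3 m[unfolded One_nat_def]) (simp add: field_simps power2_eq_square power3_eq_cube)
  qed
  moreover have "det_n 3 (\<lambda>a b. \<beta> * m a b + \<epsilon> * \<rho> \<epsilon> a b) / \<epsilon> \<ge> 0" if "\<epsilon> > 0" for \<epsilon>
  proof -
    have "(\<lambda>a b. \<epsilon> * 1 * (\<beta> * m a b + \<epsilon> * \<rho> \<epsilon> a b)) = (\<lambda>a b. (1 + \<epsilon> * m a b) powr \<beta> - 1)"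
      using that by (simp add: \<rho>_def fun_eq_iff field_simps)
    then have "\<epsilon> ^ 3 * det_n 3 (\<lambda>a b. \<beta> * m a b + \<epsilon> * \<rho> \<epsilon> a b) = det_n 3 (\<lambda>a b. (1 + \<epsilon> * m a b) powr \<beta> - 1)"
      using det_n_scale[of 3 "\<lambda>_. \<epsilon>" "\<lambda>_. 1" "\<lambda>a b. \<beta> * m a b + \<epsilon> * \<rho> \<epsilon> a b"] by simp
    also have "\<dots> = det_n 4 (\<lambda>a b. (1 + \<epsilon> * (1000 * real a * real b ^ 2 + real a ^ 3 * real b ^ 3)) powr \<beta>)"
      by (subst det_n_4_unit_border) (simp_all add: m_def)
    finally have "\<epsilon> ^ 3 * det_n 3 (\<lambda>a b. \<beta> * m a b + \<epsilon> * \<rho> \<epsilon> a b) \<ge> 0"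
      using det[OF that] by (simp only:)
    then show ?thesis
      using that by (simp only: zero_le_mult_iff zero_le_divide_iff) simp
  qed
  ultimately have "- 372394800000 * (\<beta> ^ 3 * (\<beta> - 1)) \<ge> 0"
    by (intro tendsto_lowerbound[of _ _ "at_right 0" 0]) (auto intro!: eventually_at_rightI[of 0 1])
  then show False
    using \<open>\<beta> > 0\<close> \<open>\<not> \<beta> \<le> 1\<close> by (simp add: mult_le_0_iff zero_le_mult_iff)
qed

text \<open>
  The three tests, applied to the mixed power that a preserver must be.
\<close>

lemma preserver_is_power:
  fixes F :: "('p::finite \<Rightarrow> real) \<Rightarrow> real" and X :: "'a::linorder set" and Y :: "'b::linorder set"
  assumes pres: "preserves_TP X Y k l F" and k: "\<forall>j. 1 \<le> k j"
    and N: "3 \<le> eff_order X Y l"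
    and K0: "\<forall>j. K0 j \<in> TP X Y (k j)"
    and F: "F \<in> pos_orthant \<rightarrow> {0<..}"
  shows "\<exists>j c \<beta>. c > 0 \<and> \<beta> \<ge> 1 \<and> 2 \<le> k j \<and> (4 \<le> eff_order X Y l \<longrightarrow> \<beta> = 1) \<and>
     (\<forall>t \<in> pos_orthant. F t = c * t j powr \<beta>)"
proof -
  have N2: "2 \<le> eff_order X Y l"
    by (rule order_trans[OF _ N]) simp
  obtain c \<alpha> where c: "c > 0" and \<alpha>: "\<And>j. \<alpha> j \<ge> 0" "\<exists>j. \<alpha> j \<noteq> 0" "\<And>j. k j < 2 \<Longrightarrow> \<alpha> j = 0"
    and Ft: "\<And>t. t \<in> pos_orthant \<Longrightarrow> F t = c * (\<Prod>j\<in>UNIV. t j powr \<alpha> j)"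
    using preserver_is_mixed_power[OF pres k N2 K0 F] by blast
  from \<alpha>(1,2) obtain i where i: "\<alpha> i > 0"
    by (metis less_eq_real_def)
  then have ki: "2 \<le> k i"
    using \<alpha>(3)[of i] by force
  have emb: "\<exists>f :: 'a \<Rightarrow> real. strict_mono_on X f" "\<exists>g :: 'b \<Rightarrow> real. strict_mono_on Y g"
    using real_embeddings_of_TP[OF K0[rule_format] ki] N2 by (auto simp: eff_order_ge_iff)
  obtain xs ys where t3: "enat 3 \<le> l" "xs \<in> incr_tuples 3 X" "ys \<in> incr_tuples 3 Y"
    by (rule obtain_incr_tuples_of_eff_order[of 3 X Y l]) (use N in \<open>auto simp: numeral_eq_enat\<close>)
  have "\<alpha> i \<ge> 1"
    using det_single_factor_nonneg[OF pres k c Ft emb _ t3, of 1 2 1 2 _ 0 i]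
    by (intro exponent_ge_1_of_order_3 i) (simp add: mult.assoc)
  moreover have "\<alpha> j = 0" if "j \<noteq> i" for j
  proof (rule ccontr)
    assume "\<alpha> j \<noteq> 0"
    then have "\<alpha> j > 0"
      using \<alpha>(1)[of j] by simp
    then show False
      using det_two_factors_nonneg[OF pres k c Ft emb _ t3, of 1 2 2 1 _ j i] that i
      by (intro no_two_exponents_of_order_3[of "\<alpha> j" "\<alpha> i"]) auto
  qed
  moreover have "\<alpha> i \<le> 1" if "4 \<le> eff_order X Y l"
  proof -
    obtain xs ys where t4: "enat 4 \<le> l" "xs \<in> incr_tuples 4 X" "ys \<in> incr_tuples 4 Y"
      by (rule obtain_incr_tuples_of_eff_order[of 4 X Y l]) (use \<open>4 \<le> _\<close> in \<open>auto simp: numeral_eq_enat\<close>)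
    show ?thesis
    proof (rule exponent_le_1_of_order_4[OF i])
      fix \<epsilon> :: real assume "\<epsilon> > 0"
      then show "0 \<le> det_n 4 (\<lambda>a b. (1 + \<epsilon> * (1000 * real a * (real b)\<^sup>2 + real a ^ 3 * real b ^ 3)) powr \<alpha> i)"
        using det_single_factor_nonneg[OF pres k c Ft emb _ t4, of 1 3 2 3 "\<epsilon> * 1000" \<epsilon> i]
        by (simp add: algebra_simps)
    qed
  qed
  moreover have "(\<Prod>j\<in>UNIV. t j powr \<alpha> j) = t i powr \<alpha> i" if "t \<in> pos_orthant" for t
  proof -
    have "t j powr \<alpha> j = 1" if "j \<noteq> i" for j
      using \<open>t \<in> pos_orthant\<close> calculation(2)[OF that] by (simp add: pos_orthant_def less_imp_neq[THEN not_sym])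
    then show ?thesis
      by (subst prod.remove[of _ i]) auto
  qed
  ultimately show ?thesis
    using c ki Ft by (intro exI[of _ i] exI[of _ c] exI[of _ "\<alpha> i"]) auto
qed

section \<open>The order of the remaining kernel\<close>

text \<open>
  If k j = m were below the effective order, the root of a sum of m products would be an admissible
  kernel which F turns back into that sum, a kernel with vanishing minors of size m + 1.
\<close>

lemma preserved_power_order:
  fixes F :: "('p::finite \<Rightarrow> real) \<Rightarrow> real" and X :: "'a::linorder set" and Y :: "'b::linorder set"
  assumes pres: "preserves_TP X Y k l F" and kj: "2 \<le> k j" and N: "2 \<le> eff_order X Y l"
    and K0: "\<forall>j. K0 j \<in> TP X Y (k j)"
    and F: "\<beta> > 0" "\<And>t. t \<in> pos_orthant \<Longrightarrow> F t = c * t j powr \<beta>" and k: "\<forall>j. 1 \<le> k j"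
    and root: "\<And>K. k j < eff_order X Y l \<Longrightarrow> K \<in> TP X Y (k j) \<Longrightarrow> (\<lambda>x y. K x y powr (1 / \<beta>)) \<in> TP X Y (k j)"
  shows "k j \<ge> eff_order X Y l"
proof (rule ccontr)
  assume "\<not> k j \<ge> eff_order X Y l"
  then have less: "k j < eff_order X Y l" by simp
  then obtain m where m: "k j = enat m" by (cases "k j") auto
  have emb: "\<exists>f :: 'a \<Rightarrow> real. strict_mono_on X f" "\<exists>g :: 'b \<Rightarrow> real. strict_mono_on Y g"
    using real_embeddings_of_TP[OF K0[rule_format] kj] N by (auto simp: eff_order_ge_iff)
  then obtain f :: "'a \<Rightarrow> real" and g :: "'b \<Rightarrow> real" where fg: "strict_mono_on X f" "strict_mono_on Y g"
    by blast
  define u v where "u i x = exp (real i * f x)" and "v i y = exp (real i * g y)" for i :: nat and x y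
  define R where "R x y = (\<Sum>i<m. u i x * v i y)" for x y
  have "u \<in> TP UNIV X \<infinity>" "v \<in> TP UNIV Y \<infinity>"
    unfolding u_def[abs_def] v_def[abs_def] by (intro TP_exponential_family fg; simp add: strict_mono_def)+
  then have R: "R \<in> TP X Y (k j)"
    unfolding m R_def[abs_def] by (rule TP_sum_of_products)
  have Rpos: "R x y > 0" if "x \<in> X" "y \<in> Y" for x y
    using TP_pos[OF R _ that] k by simp
  define K where "K = K0(j := (\<lambda>x y. R x y powr (1 / \<beta>)))"
  have K: "K i \<in> TP X Y (k i)" for i
    using root[OF less R] K0 by (simp add: K_def)
  have Kpos: "K i x y > 0" if "x \<in> X" "y \<in> Y" for i x y
    using TP_pos[OF K[of i] _ that] k by simp
  have "compose_kernels F K \<in> TP X Y l"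
    using pres K by (simp add: preserves_TP_def)
  then have cR: "(\<lambda>x y. c * 1 * R x y) \<in> TP X Y l"
  proof (rule TP_cong)
    fix x y assume xy: "x \<in> X" "y \<in> Y"
    then have "compose_kernels F K x y = c * (K j x y powr \<beta>)"
      using Kpos by (simp add: compose_kernels_def F(2) pos_orthant_def)
    then show "c * 1 * R x y = compose_kernels F K x y"
      using F(1) Rpos[OF xy] by (simp add: K_def powr_powr)
  qed
  have "enat (Suc m) \<le> eff_order X Y l"
    using less m ileI1[of "enat m"] by (simp add: eSuc_enat)
  then obtain xs ys where t: "enat (Suc m) \<le> l" "xs \<in> incr_tuples (Suc m) X" "ys \<in> incr_tuples (Suc m) Y"
    using obtain_incr_tuples_of_eff_order by metis
  have "det_n (Suc m) (\<lambda>a b. c * 1 * R (xs ! a) (ys ! b)) > 0"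
    using TP_det_n_pos[OF cR _ t] by simp
  moreover have "det_n (Suc m) (\<lambda>a b. R (xs ! a) (ys ! b)) = 0"
    unfolding R_def by (rule det_sum_of_few_products) simp
  ultimately show False
    using det_n_scale[of "Suc m" "\<lambda>_. c" "\<lambda>_. 1" "\<lambda>a b. R (xs ! a) (ys ! b)"] by simp
qed

section \<open>Entrywise powers of positive 3 x 3 matrices\<close>

lemma Bernoulli_powr:
  fixes \<alpha> u :: real
  assumes "\<alpha> \<ge> 1" "u \<ge> 1"
  shows "1 + \<alpha> * (u - 1) \<le> u powr \<alpha>"
proof -
  have "(\<lambda>u. u powr \<alpha> - \<alpha> * u) 1 \<le> (\<lambda>u. u powr \<alpha> - \<alpha> * u) u"
  proof (rule DERIV_nonneg_imp_nondecreasing[OF \<open>u \<ge> 1\<close>])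
    fix x :: real assume "1 \<le> x"
    then have "((\<lambda>u. u powr \<alpha> - \<alpha> * u) has_real_derivative \<alpha> * x powr (\<alpha> - 1) - \<alpha>) (at x)"
      by (auto intro!: derivative_eq_intros)
    moreover have "\<alpha> * x powr (\<alpha> - 1) - \<alpha> \<ge> 0"
      using assms(1) \<open>1 \<le> x\<close> ge_one_powr_ge_zero[of x "\<alpha> - 1"] by simp
    ultimately show "\<exists>y. ((\<lambda>u. u powr \<alpha> - \<alpha> * u) has_real_derivative y) (at x) \<and> 0 \<le> y" by blast
  qed
  then show ?thesis by (simp add: algebra_simps)
qed

text \<open>
  The quotient is, up to the factor \<alpha>, the logarithmic derivative of (1 + x) powr \<alpha> - 1 with respect
  to ln x, where u = 1 + x.
\<close>

lemma elasticity_mono: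
  fixes \<alpha> u v :: real
  assumes "\<alpha> \<ge> 1" "1 < u" "u \<le> v"
  shows "(u powr \<alpha> - u powr (\<alpha> - 1)) / (u powr \<alpha> - 1) \<le> (v powr \<alpha> - v powr (\<alpha> - 1)) / (v powr \<alpha> - 1)"
proof (rule DERIV_nonneg_imp_nondecreasing[OF assms(3)])
  fix x :: real assume "u \<le> x"
  then have x: "x > 1" using assms by simp
  then have gt: "x powr \<alpha> > 1" using assms by (simp add: gr_one_powr)
  let ?D = "x powr (\<alpha> - 2) * (x powr \<alpha> - \<alpha> * x + \<alpha> - 1) / (x powr \<alpha> - 1)\<^sup>2"
  have p: "x powr \<alpha> = x\<^sup>2 * x powr (\<alpha> - 2)" "x powr (\<alpha> - 1) = x * x powr (\<alpha> - 2)"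
      "x powr (\<alpha> - 1 - 1) = x powr (\<alpha> - 2)"
    using x by (simp_all add: powr_diff power2_eq_square field_simps)
  \<comment> \<open>In the quotient rule all terms but a Bernoulli expression cancel.\<close>
  have "((\<lambda>x. (x powr \<alpha> - x powr (\<alpha> - 1)) / (x powr \<alpha> - 1)) has_real_derivative
     ((\<alpha> * x powr (\<alpha> - 1) - (\<alpha> - 1) * x powr (\<alpha> - 1 - 1)) * (x powr \<alpha> - 1)
       - (x powr \<alpha> - x powr (\<alpha> - 1)) * (\<alpha> * x powr (\<alpha> - 1))) / ((x powr \<alpha> - 1) * (x powr \<alpha> - 1))) (at x)"
    using x gt by (auto intro!: derivative_eq_intros)
  moreover have "((\<alpha> * x powr (\<alpha> - 1) - (\<alpha> - 1) * x powr (\<alpha> - 1 - 1)) * (x powr \<alpha> - 1)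
       - (x powr \<alpha> - x powr (\<alpha> - 1)) * (\<alpha> * x powr (\<alpha> - 1))) / ((x powr \<alpha> - 1) * (x powr \<alpha> - 1)) = ?D"
    unfolding p by (simp add: power2_eq_square) (simp add: algebra_simps)
  moreover have "?D \<ge> 0"
    using Bernoulli_powr[of \<alpha> x] assms(1) x by (intro divide_nonneg_nonneg mult_nonneg_nonneg) (auto simp: algebra_simps)
  ultimately show "\<exists>y. ((\<lambda>x. (x powr \<alpha> - x powr (\<alpha> - 1)) / (x powr \<alpha> - 1)) has_real_derivative y) (at x) \<and> 0 \<le> y"
    by auto
qed

text \<open>
  The sign of the derivative compares the elasticities at c * z and z.
\<close>

lemma powr_shift_ratio_mono:
  fixes \<alpha> c x y :: real
  assumes "\<alpha> \<ge> 1" "c \<ge> 1" "0 < x" "x \<le> y"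
  shows "((1 + c * x) powr \<alpha> - 1) / ((1 + x) powr \<alpha> - 1) \<le> ((1 + c * y) powr \<alpha> - 1) / ((1 + y) powr \<alpha> - 1)"
proof (rule DERIV_nonneg_imp_nondecreasing[OF assms(4)])
  fix z assume "x \<le> z"
  then have z: "z > 0" "c * z > 0" "z \<le> c * z" using assms by auto
  then have base: "1 + z > 0" "1 + c * z > 0" by linarith+
  have gt: "(1 + z) powr \<alpha> > 1" "(1 + c * z) powr \<alpha> > 1" using assms z by (auto simp: gr_one_powr)
  define p q p' q' where pq: "p = (1 + z) powr \<alpha> - 1" "q = (1 + c * z) powr \<alpha> - 1"
    "p' = (1 + z) powr (\<alpha> - 1)" "q' = (1 + c * z) powr (\<alpha> - 1)"
  have pos: "p > 0" "q > 0" using gt by (auto simp: pq)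
  have "((\<lambda>x. ((1 + c * x) powr \<alpha> - 1) / ((1 + x) powr \<alpha> - 1)) has_real_derivative
     ((\<alpha> * q' * c) * p - q * (\<alpha> * p')) / (p * p)) (at z)"
    unfolding pq using base gt by (auto intro!: derivative_eq_intros)
  moreover have "(\<alpha> * q' * c) * p - q * (\<alpha> * p') \<ge> 0"
  proof -
    have "(1 + w) powr \<alpha> - (1 + w) powr (\<alpha> - 1) = w * (1 + w) powr (\<alpha> - 1)" if "w > 0" for w
      using that by (simp add: powr_diff field_simps)
    then have "z * p' / p \<le> c * z * q' / q"
      using elasticity_mono[of \<alpha> "1 + z" "1 + c * z"] assms(1) z by (simp add: pq)
    then have "z * (p' * q) \<le> z * (c * q' * p)"
      using pos by (simp add: field_simps)
    then have "\<alpha> * (p' * q) \<le> \<alpha> * (c * q' * p)"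
      using z assms(1) by simp
    then show ?thesis by (simp add: algebra_simps)
  qed
  ultimately show "\<exists>y. ((\<lambda>x. ((1 + c * x) powr \<alpha> - 1) / ((1 + x) powr \<alpha> - 1)) has_real_derivative y) (at z) \<and> 0 \<le> y"
    using pos by (intro exI conjI divide_nonneg_nonneg) auto
qed

text \<open>
  Convexity of ln ((1 + exp s) powr \<alpha> - 1) in s, in multiplicative form.
\<close>

lemma powr_shift_log_convex:
  fixes \<alpha> a b c d :: real
  assumes "\<alpha> \<ge> 1" "0 < a" "a < b" "a < c" "b * c < a * d"
  shows "((1 + b) powr \<alpha> - 1) * ((1 + c) powr \<alpha> - 1) < ((1 + a) powr \<alpha> - 1) * ((1 + d) powr \<alpha> - 1)"
proof -
  \<comment> \<open>The factor r takes a to c and b to r * b, which lies below d.\<close>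
  define r where "r = c / a"
  have r: "r > 1" "c = r * a" using assms by (auto simp: r_def)
  have "a * (r * b) < a * d" using assms(5) r by (simp add: mult_ac)
  then have rb: "r * b < d" "r * b > 0" using assms r by auto
  have gt: "(1 + a) powr \<alpha> > 1" "(1 + b) powr \<alpha> > 1"
    using assms by (auto simp: gr_one_powr)
  have "((1 + r * a) powr \<alpha> - 1) / ((1 + a) powr \<alpha> - 1) \<le> ((1 + r * b) powr \<alpha> - 1) / ((1 + b) powr \<alpha> - 1)"
    using assms r by (intro powr_shift_ratio_mono) auto
  then have "((1 + b) powr \<alpha> - 1) * ((1 + c) powr \<alpha> - 1) \<le> ((1 + a) powr \<alpha> - 1) * ((1 + r * b) powr \<alpha> - 1)"
    using gt r by (simp add: field_simps)
  also have "\<dots> < ((1 + a) powr \<alpha> - 1) * ((1 + d) powr \<alpha> - 1)"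
    using gt rb assms by (intro mult_strict_left_mono diff_strict_right_mono powr_less_mono2) auto
  finally show ?thesis .
qed

lemma det_3_powr_pos:
  fixes M :: "nat \<Rightarrow> nat \<Rightarrow> real"
  assumes \<alpha>: "\<alpha> \<ge> 1" and pos: "\<And>i j. i < 3 \<Longrightarrow> j < 3 \<Longrightarrow> M i j > 0"
    and minors: "\<And>i i' j j'. i < i' \<Longrightarrow> i' < 3 \<Longrightarrow> j < j' \<Longrightarrow> j' < 3 \<Longrightarrow> M i j' * M i' j < M i j * M i' j'"
    and det: "det_n 3 M > 0"
  shows "det_n 3 (\<lambda>i j. M i j powr \<alpha>) > 0"
proof -
  \<comment> \<open>Row and column scalings make row and column 0 constant 1, leaving a 2 x 2 determinant.\<close>
  define u v where "u i = M i 0 / M 0 0" and "v j = M 0 j" for i j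
  define B where "B i j = (if i = 0 \<or> j = 0 then 1 else M i j / (u i * v j))" for i j
  have uv: "u i > 0" "v i > 0" if "i < 3" for i
    using that pos by (auto simp: u_def v_def)
  have M: "M i j = u i * v j * B i j" if "i < 3" "j < 3" for i j
  proof (cases "i = 0 \<or> j = 0")
    case True
    then show ?thesis using pos[of 0 0] by (auto simp: u_def v_def B_def)
  next
    case False
    then show ?thesis using uv[OF that(1)] uv[OF that(2)] by (simp add: B_def)
  qed
  have Bpos: "B i j > 0" if "i < 3" "j < 3" for i j
    using pos[OF that] uv[OF that(1)] uv[OF that(2)] by (simp add: B_def)
  have scale: "(\<Prod>i<3. u i) > 0" "(\<Prod>j<3. v j) > 0"
    using uv by (auto intro!: prod_pos)
  have "det_n 3 M = (\<Prod>i<3. u i) * (\<Prod>j<3. v j) * det_n 3 B"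
    by (subst det_n_scale[symmetric]) (intro det_n_cong M)
  then have "det_n 3 B > 0"
    using det scale by (metis mult_pos_pos zero_less_mult_pos)
  then have detB: "(B 1 2 - 1) * (B 2 1 - 1) < (B 1 1 - 1) * (B 2 2 - 1)"
    by (subst (asm) det_n_3_unit_border) (auto simp: B_def)
  have minorB: "B i j' * B i' j < B i j * B i' j'" if "i < i'" "i' < 3" "j < j'" "j' < 3" for i i' j j'
  proof -
    have "(u i * v j * u i' * v j') * (B i j' * B i' j) < (u i * v j * u i' * v j') * (B i j * B i' j')"
      using minors[OF that] that by (simp add: M mult_ac)
    then show ?thesis
      using uv[of i] uv[of i'] uv[of j] uv[of j'] that by simp
  qed
  have *: "1 < B 1 1" "B 1 1 < B 1 2" "B 1 1 < B 2 1"
    using minorB[of 0 1 0 1] minorB[of 0 1 1 2] minorB[of 1 2 0 1] by (auto simp: B_def)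
  have "(B 1 2 powr \<alpha> - 1) * (B 2 1 powr \<alpha> - 1) < (B 1 1 powr \<alpha> - 1) * (B 2 2 powr \<alpha> - 1)"
    using powr_shift_log_convex[OF \<alpha>, of "B 1 1 - 1" "B 1 2 - 1" "B 2 1 - 1" "B 2 2 - 1"] * detB by simp
  then have "det_n 3 (\<lambda>i j. B i j powr \<alpha>) > 0"
    by (subst det_n_3_unit_border) (auto simp: B_def)
  then have "0 < (\<Prod>i<3. u i powr \<alpha>) * (\<Prod>j<3. v j powr \<alpha>) * det_n 3 (\<lambda>i j. B i j powr \<alpha>)"
    using uv by (intro mult_pos_pos prod_pos) fastforce+
  also have "\<dots> = det_n 3 (\<lambda>i j. M i j powr \<alpha>)"
    unfolding det_n_scale[symmetric]
    by (intro det_n_cong) (simp add: M powr_mult uv Bpos less_imp_le)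
  finally show ?thesis .
qed

section \<open>Preservers\<close>

lemma mixed_power_preserves_TP_2:
  fixes F :: "('p::finite \<Rightarrow> real) \<Rightarrow> real"
  assumes N: "eff_order X Y l \<le> 2" and k: "\<forall>j. 1 \<le> k j"
    and F: "c > 0" "\<And>t. t \<in> pos_orthant \<Longrightarrow> F t = c * (\<Prod>j\<in>UNIV. t j powr \<alpha> j)"
    and \<alpha>: "\<And>j. \<alpha> j \<ge> 0" "\<exists>j. \<alpha> j \<noteq> 0" "\<And>j. k j < 2 \<Longrightarrow> \<alpha> j = 0"
  shows "preserves_TP X Y k l F"
  unfolding preserves_TP_def
proof (intro allI impI TP_up_to_2 N)
  fix K assume K: "\<forall>j. K j \<in> TP X Y (k j)"
  have pos: "K j x y > 0" if "x \<in> X" "y \<in> Y" for j x y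
    using TP_pos[OF K[rule_format] _ that] k by simp
  have F': "compose_kernels F K x y = c * (\<Prod>j\<in>UNIV. K j x y powr \<alpha> j)" if "x \<in> X" "y \<in> Y" for x y
    using pos[OF that] by (simp add: compose_kernels_def F(2) pos_orthant_def)
  show "compose_kernels F K x y > 0" if "x \<in> X" "y \<in> Y" for x y
    using pos[OF that] F(1) by (auto simp: F'[OF that] less_imp_neq[THEN not_sym] intro!: mult_pos_pos prod_pos)
  fix x x' y y'
  assume xy: "x \<in> X" "x' \<in> X" "x < x'" "y \<in> Y" "y' \<in> Y" "y < y'"
  obtain i where i: "\<alpha> i > 0" using \<alpha>(1,2) by (metis less_eq_real_def)
  let ?p = "\<lambda>j. (K j x y' * K j x' y) powr \<alpha> j" and ?q = "\<lambda>j. (K j x y * K j x' y') powr \<alpha> j"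
  have lt: "?p j < ?q j" if "\<alpha> j > 0" for j
  proof -
    have "2 \<le> k j" using \<alpha>(3)[of j] that by force
    from TP_minor_2[OF K[rule_format] this xy] show ?thesis
      using that pos xy by (intro powr_less_mono2) (auto simp: less_imp_le)
  qed
  have pp: "?p j > 0" for j
    using pos xy by (simp add: less_imp_neq[THEN not_sym])
  have le: "?p j \<le> ?q j" for j
    using lt[of j] \<alpha>(1)[of j] pos xy by (cases "\<alpha> j = 0") (auto simp: less_imp_neq[THEN not_sym])
  have "(\<Prod>j\<in>UNIV. ?p j) < (\<Prod>j\<in>UNIV. ?q j)"
  proof -
    have "?p i * (\<Prod>j\<in>UNIV - {i}. ?p j) < ?q i * (\<Prod>j\<in>UNIV - {i}. ?q j)"
    proof (rule mult_less_le_imp_less[OF lt[OF i]])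
      show "(\<Prod>j\<in>UNIV - {i}. ?p j) \<le> (\<Prod>j\<in>UNIV - {i}. ?q j)"
        using le pp by (intro prod_mono) (simp add: less_imp_le)
      show "0 < (\<Prod>j\<in>UNIV - {i}. ?p j)"
        using pp by (intro prod_pos) simp
    qed (use pp[of i] in simp)
    then show ?thesis
      by (simp add: prod.remove[of UNIV i])
  qed
  then have "(c * c) * (\<Prod>j\<in>UNIV. ?p j) < (c * c) * (\<Prod>j\<in>UNIV. ?q j)"
    using F(1) by simp
  then show "compose_kernels F K x y' * compose_kernels F K x' y < compose_kernels F K x y * compose_kernels F K x' y'"
    using pos xy by (simp add: F' powr_mult less_imp_le prod.distrib mult_ac)
qed

lemma power_preserves_TP_3:
  fixes F :: "('p::finite \<Rightarrow> real) \<Rightarrow> real"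
  assumes N: "eff_order X Y l = 3" and k: "\<forall>j. 1 \<le> k j"
    and F: "c > 0" "\<And>t. t \<in> pos_orthant \<Longrightarrow> F t = c * t j powr \<beta>"
    and \<beta>: "\<beta> \<ge> 1" and kj: "3 \<le> k j"
  shows "preserves_TP X Y k l F"
  unfolding preserves_TP_def
proof (intro allI impI)
  fix K assume K: "\<forall>j. K j \<in> TP X Y (k j)"
  have pos: "K j x y > 0" if "x \<in> X" "y \<in> Y" for j x y
    using TP_pos[OF K[rule_format] _ that] k by simp
  have kj2: "2 \<le> k j"
    by (rule order_trans[OF _ kj]) simp
  have "(\<lambda>x y. K j x y powr \<beta>) \<in> TP X Y l"
  proof (rule TP_I)
    fix r xs ys assume r: "1 \<le> r" "enat r \<le> l" and xs: "xs \<in> incr_tuples r X" and ys: "ys \<in> incr_tuples r Y"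
    have mem: "a < r \<Longrightarrow> xs ! a \<in> X" "a < r \<Longrightarrow> ys ! a \<in> Y" for a
      using xs ys by (auto simp: incr_tuples_iff_nth)
    have r3: "enat r \<le> 3"
      using incr_tuples_le_eff_order[OF r(2) xs ys] N by simp
    have K2: "(\<lambda>x y. K j x y powr \<beta>) \<in> TP X Y 2"
      using K kj2 \<beta> by (intro TP_powr_up_to_2 TP_antimono[OF kj2]) auto
    show "0 < det_n r (\<lambda>i i'. K j (xs ! i) (ys ! i') powr \<beta>)"
    proof (cases "r = 3")
      case False
      then have "enat r \<le> 2" using r3 by (simp add: numeral_eq_enat)
      then show ?thesis
        using TP_det_n_pos[OF K2 r(1) _ xs ys] by simp
    next
      case True
      have "det_n 3 (\<lambda>i i'. K j (xs ! i) (ys ! i')) > 0"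
        using TP_det_n_pos[of "K j" X Y "k j" 3 xs ys] K kj xs ys True by (simp add: numeral_eq_enat)
      moreover have "K j (xs ! a) (ys ! b') * K j (xs ! a') (ys ! b) < K j (xs ! a) (ys ! b) * K j (xs ! a') (ys ! b')"
        if "a < a'" "a' < 3" "b < b'" "b' < 3" for a a' b b'
        using that True xs ys by (intro TP_minor_2[OF K[rule_format] kj2] mem) (auto simp: incr_tuples_iff_nth)
      ultimately show ?thesis
        unfolding True using mem pos True by (intro det_3_powr_pos \<beta>) auto
    qed
  qed
  then have "(\<lambda>x y. c * 1 * (K j x y powr \<beta>)) \<in> TP X Y l"
    using F(1) by (intro TP_scale) auto
  then show "compose_kernels F K \<in> TP X Y l"
    by (rule TP_cong) (use pos in \<open>simp add: compose_kernels_def F(2) pos_orthant_def\<close>)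
qed

lemma homothety_preserves_TP:
  fixes F :: "('p::finite \<Rightarrow> real) \<Rightarrow> real"
  assumes k: "\<forall>j. 1 \<le> k j"
    and F: "c > 0" "\<And>t. t \<in> pos_orthant \<Longrightarrow> F t = c * t j"
    and kj: "eff_order X Y l \<le> k j"
  shows "preserves_TP X Y k l F"
  unfolding preserves_TP_def
proof (intro allI impI)
  fix K assume K: "\<forall>j. K j \<in> TP X Y (k j)"
  have pos: "K j x y > 0" if "x \<in> X" "y \<in> Y" for j x y
    using TP_pos[OF K[rule_format] _ that] k by simp
  have "K j \<in> TP X Y l"
  proof (rule TP_I)
    fix r xs ys assume r: "1 \<le> r" "enat r \<le> l" and t: "xs \<in> incr_tuples r X" "ys \<in> incr_tuples r Y"
    show "det_n r (\<lambda>a b. K j (xs ! a) (ys ! b)) > 0"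
      by (rule TP_det_n_pos[OF K[rule_format] r(1) order_trans[OF incr_tuples_le_eff_order[OF r(2) t] kj] t])
  qed
  then have "(\<lambda>x y. c * 1 * K j x y) \<in> TP X Y l"
    using F(1) by (intro TP_scale) auto
  then show "compose_kernels F K \<in> TP X Y l"
    by (rule TP_cong) (use pos in \<open>simp add: compose_kernels_def F(2) pos_orthant_def\<close>)
qed

theorem theorem1p6:
  fixes X :: "'a::linorder set" and Y :: "'b::linorder set"
    and k :: "'p::finite \<Rightarrow> enat" and l :: enat
    and F :: "('p \<Rightarrow> real) \<Rightarrow> real"
  assumes "X \<noteq> {}" and "Y \<noteq> {}"
    and "\<forall>j. 1 \<le> k j" and "1 \<le> l"
    and nonvacuous: "2 \<le> eff_order X Y l \<longrightarrow> (\<exists>K. \<forall>j. K j \<in> TP X Y (k j))"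
    and "F \<in> pos_orthant \<rightarrow> {0<..}"
  shows
    "(eff_order X Y l = 1 \<longrightarrow> preserves_TP X Y k l F) \<and>
     (eff_order X Y l = 2 \<longrightarrow>
        (preserves_TP X Y k l F \<longleftrightarrow>
          (\<exists>c \<alpha>. c > 0 \<and> (\<forall>j. \<alpha> j \<ge> 0) \<and> (\<exists>j. \<alpha> j \<noteq> 0) \<and>
             (\<forall>j. k j < eff_order X Y l \<longrightarrow> \<alpha> j = 0) \<and>
             (\<forall>t \<in> pos_orthant. F t = c * (\<Prod>j\<in>UNIV. t j powr \<alpha> j))))) \<and>
     (eff_order X Y l = 3 \<longrightarrow>
        (preserves_TP X Y k l F \<longleftrightarrow>
          (\<exists>j c \<alpha>. c > 0 \<and> \<alpha> \<ge> 1 \<and> k j \<ge> eff_order X Y l \<and>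
             (\<forall>t \<in> pos_orthant. F t = c * t j powr \<alpha>)))) \<and>
     (4 \<le> eff_order X Y l \<longrightarrow>
        (infinite X \<and> infinite Y \<and> l < \<infinity> \<longrightarrow> (\<forall>j. k j < \<infinity>)) \<longrightarrow>
        (preserves_TP X Y k l F \<longleftrightarrow>
          (\<exists>j c. c > 0 \<and> k j \<ge> eff_order X Y l \<and>
             (\<forall>t \<in> pos_orthant. F t = c * t j))))"
proof (intro conjI impI)
  note k = assms(3) and F = assms(6)
  {
    assume N: "eff_order X Y l = 1"
    show "preserves_TP X Y k l F"
      unfolding preserves_TP_def
    proof (intro allI impI TP_I)
      fix K r xs ys
      assume K: "\<forall>j. K j \<in> TP X Y (k j)" and r: "1 \<le> r" "enat r \<le> l"
        and xs: "xs \<in> incr_tuples r X" and ys: "ys \<in> incr_tuples r Y"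
      have "r = Suc 0"
        using incr_tuples_le_eff_order[OF r(2) xs ys] r(1) N by (simp add: one_enat_def)
      moreover have "K j (xs ! 0) (ys ! 0) > 0" for j
        using TP_pos[OF K[rule_format, of j]] k xs ys \<open>r = Suc 0\<close> by (simp add: incr_tuples_iff_nth)
      ultimately show "det_n r (\<lambda>i j. compose_kernels F K (xs ! i) (ys ! j)) > 0"
        using F by (auto simp: det_n_1 compose_kernels_def pos_orthant_def Pi_iff)
    qed
  next
    assume N: "eff_order X Y l = 2"
    then obtain K0 where K0: "\<forall>j. K0 j \<in> TP X Y (k j)"
      using nonvacuous by auto
    show "preserves_TP X Y k l F \<longleftrightarrow>
          (\<exists>c \<alpha>. c > 0 \<and> (\<forall>j. \<alpha> j \<ge> 0) \<and> (\<exists>j. \<alpha> j \<noteq> 0) \<and>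
             (\<forall>j. k j < eff_order X Y l \<longrightarrow> \<alpha> j = 0) \<and>
             (\<forall>t \<in> pos_orthant. F t = c * (\<Prod>j\<in>UNIV. t j powr \<alpha> j)))"
      unfolding N
    proof
      assume "preserves_TP X Y k l F"
      then show "\<exists>c \<alpha>. c > 0 \<and> (\<forall>j. \<alpha> j \<ge> 0) \<and> (\<exists>j. \<alpha> j \<noteq> 0) \<and> (\<forall>j. k j < 2 \<longrightarrow> \<alpha> j = 0) \<and>
             (\<forall>t \<in> pos_orthant. F t = c * (\<Prod>j\<in>UNIV. t j powr \<alpha> j))"
        using N by (intro preserver_is_mixed_power[OF _ k _ K0 F]) auto
    qed (use N in \<open>auto intro!: mixed_power_preserves_TP_2[OF _ k]\<close>)
  next
    assume N: "eff_order X Y l = 3"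
    then obtain K0 where K0: "\<forall>j. K0 j \<in> TP X Y (k j)"
      using nonvacuous by auto
    show "preserves_TP X Y k l F \<longleftrightarrow>
          (\<exists>j c \<alpha>. c > 0 \<and> \<alpha> \<ge> 1 \<and> k j \<ge> eff_order X Y l \<and>
             (\<forall>t \<in> pos_orthant. F t = c * t j powr \<alpha>))"
    proof
      assume pres: "preserves_TP X Y k l F"
      then obtain j c \<beta> where c: "c > 0" "\<beta> \<ge> 1" "2 \<le> k j" "\<And>t. t \<in> pos_orthant \<Longrightarrow> F t = c * t j powr \<beta>"
        using preserver_is_power[OF pres k _ K0 F] N by auto
      have "k j \<ge> eff_order X Y l"
      proof (rule preserved_power_order[OF pres c(3) _ K0 _ c(4) k])
        fix K assume "k j < eff_order X Y l" and K: "K \<in> TP X Y (k j)"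
        then have "k j \<le> 2" using N by (cases "k j") (auto simp: numeral_eq_enat)
        then show "(\<lambda>x y. K x y powr (1 / \<beta>)) \<in> TP X Y (k j)"
          using K k c(2) by (intro TP_powr_up_to_2) auto
      qed (use N c in auto)
      then show "\<exists>j c \<alpha>. c > 0 \<and> \<alpha> \<ge> 1 \<and> k j \<ge> eff_order X Y l \<and> (\<forall>t \<in> pos_orthant. F t = c * t j powr \<alpha>)"
        using c by blast
    qed (use N in \<open>auto intro!: power_preserves_TP_3[OF _ k]\<close>)
  next
    assume N: "4 \<le> eff_order X Y l"
    have N': "2 \<le> eff_order X Y l" "3 \<le> eff_order X Y l"
      by (rule order_trans[OF _ N], simp)+
    then obtain K0 where K0: "\<forall>j. K0 j \<in> TP X Y (k j)"
      using nonvacuous by auto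
    show "preserves_TP X Y k l F \<longleftrightarrow>
          (\<exists>j c. c > 0 \<and> k j \<ge> eff_order X Y l \<and> (\<forall>t \<in> pos_orthant. F t = c * t j))"
    proof
      assume pres: "preserves_TP X Y k l F"
      then obtain j c where c: "c > 0" "2 \<le> k j" "\<And>t. t \<in> pos_orthant \<Longrightarrow> F t = c * t j powr 1"
        using preserver_is_power[OF pres k N'(2) K0 F] N by auto
      have "k j \<ge> eff_order X Y l"
      proof (rule preserved_power_order[OF pres c(2) N'(1) K0 _ c(3) k])
        fix K assume K: "K \<in> TP X Y (k j)"
        then show "(\<lambda>x y. K x y powr (1 / 1)) \<in> TP X Y (k j)"
          using TP_pos[OF K] k by (intro TP_cong[OF K]) (simp add: less_imp_le)
      qed auto
      moreover have "F t = c * t j" if "t \<in> pos_orthant" for t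
        using c(3)[OF that] that by (simp add: pos_orthant_def less_imp_le)
      ultimately show "\<exists>j c. c > 0 \<and> k j \<ge> eff_order X Y l \<and> (\<forall>t \<in> pos_orthant. F t = c * t j)"
        using c(1) by blast
    qed (auto intro!: homothety_preserves_TP[OF k])
  }
qed

end
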